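(* Let $m\ge 1$ be an integer, let $u_-=u_0<u_1<\cdots<u_m<u_{m+1}=u_+$ be real numbers, let $a_i>0$, $k_i>0$ for $i=0,\dots,m$ and $d_i\ge 0$ for $i=1,\dots,m$. Then there exists a unique self-similar solution (in the sense defined in the context) of the one-dimensional multi-phase Stefan problem with Riemann initial data $u(0,x)=u_-$ for $x<0$, $u(0,x)=u_+$ for $x>0$; that is, there is exactly one tuple of real numbers $\xi_1<\cdots<\xi_m$ such that the function $u(t,x)=v(x/\sqrt{t})$, with $$v(\xi)=u_i+\frac{u_{i+1}-u_i}{F(\xi_{i+1}/a_i)-F(\xi_i/a_i)}\bigl(F(\xi/a_i)-F(\xi_i/a_i)\bigr),\quad \xi_i<\xi<\xi_{i+1},\ i=0,\ldots,m,$$ where $\xi_0=-\infty$, $\xi_{m+1}=+\infty$, solves this problem. Moreover, this tuple $(\xi_1,\ldots,\xi_m)$ is the minimum point of the function $$E(\bar\xi)=-\sum_{i=0}^m k_i(u_{i+1}-u_i)\ln\bigl(F(\xi_{i+1}/a_i)-F(\xi_i/a_i)\bigr)+\sum_{i=1}^m \frac{d_i\xi_i^2}{4}$$ on $\Omega=\{\bar\xi=(\xi_1,\ldots,\xi_m)\in\mathbb{R}^m : \xi_1<\cdots<\xi_m\}$, and $E$ is strictly convex and coercive on $\Omega$.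
   Context: $F(\xi)=\frac{1}{2\sqrt{\pi}}\int_{-\infty}^{\xi}e^{-s^2/4}\,ds$ for $\xi\in\mathbb{R}$, with $F(-\infty)=0$, $F(+\infty)=1$. Coercive means that the sets $\{\bar\xi\in\Omega: E(\bar\xi)\le c\}$ are compact for each $c>0$. The Stefan problem is posed in the half-plane $\{(t,x): t>0,\ x\in\mathbb{R}\}$: (i) $u_t=a_i^2u_{xx}$ in the regions where $u_i<u<u_{i+1}$, $i=0,\dots,m$; (ii) on the (unknown) phase transition lines $x=x_i(t)$, where $u=u_i$, $i=1,\dots,m$, the Stefan condition $d_ix_i'(t)+k_iu_x(t,x_i(t)+)-k_{i-1}u_x(t,x_i(t)-)=0$ holds, where $u_x(t,x_i(t)+)$ and $u_x(t,x_i(t)-)$ are the one-sided limits of $u_x$ from the warmer ($u>u_i$) and the colder ($u<u_i$) phase respectively; (iii) the initial condition $u(0,x)=u_-$ for $x<0$, $u(0,x)=u_+$ for $x>0$ (as limits when $t\to0+$). A self-similar solution is a function $u(t,x)=v(x/\sqrt t)$ of the form displayed in the claim (extended continuously by $v(\xi_i)=u_i$), whose phase transition lines are $x_i(t)=\xi_i\sqrt{t}$, satisfying (i)–(iii). For a function of this form, (i) and (iii) hold automatically, and (ii) is equivalent to the system $$\frac{d_i\xi_i}{2}+\frac{k_i(u_{i+1}-u_i)F'(\xi_i/a_i)}{a_i(F(\xi_{i+1}/a_i)-F(\xi_i/a_i))}-\frac{k_{i-1}(u_i-u_{i-1})F'(\xi_i/a_{i-1})}{a_{i-1}(F(\xi_i/a_{i-1})-F(\xi_{i-1}/a_{i-1}))}=0,\quad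 i=1,\ldots,m.$$ *)

theory Defs
  imports "HOL-Analysis.Analysis"
begin

text \<open>A tuple \<open>(\<xi>\<^sub>1, \<dots>, \<xi>\<^sub>m)\<close> is a function \<open>nat \<Rightarrow> real\<close> that vanishes outside \<open>{1..m}\<close>, so that
  distinct tuples are distinct functions. As in HOL-Analysis's \<open>Euclidean_space\<close>, the product
  topology on \<open>nat \<Rightarrow> real\<close> then induces the usual topology of \<open>m\<close>-dimensional Euclidean space.\<close>

definition Omega :: "nat \<Rightarrow> (nat \<Rightarrow> real) set" where
  "Omega m = {\<xi>. (\<forall>i. i \<notin> {1..m} \<longrightarrow> \<xi> i = 0) \<and> strict_mono_on {1..m} \<xi>}"

text \<open>The tuple completed by \<open>\<xi>\<^sub>0 = -\<infinity>\<close> and \<open>\<xi>\<^sub>m\<^sub>+\<^sub>1 = +\<infinity>\<close>.\<close>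

definition bdry :: "nat \<Rightarrow> (nat \<Rightarrow> real) \<Rightarrow> nat \<Rightarrow> ereal" where
  "bdry m \<xi> i = (if i = 0 then -\<infinity> else if i \<le> m then ereal (\<xi> i) else \<infinity>)"

definition F :: "ereal \<Rightarrow> real" where
  "F x = (case x of
      ereal r \<Rightarrow> 1 / (2 * sqrt pi) * (LINT s:{..r}|lborel. exp (- (s\<^sup>2) / 4))
    | PInfty \<Rightarrow> 1
    | MInfty \<Rightarrow> 0)"

text \<open>The index \<open>i\<close> below is the one with \<open>\<xi>\<^sub>i \<le> y < \<xi>\<^sub>i\<^sub>+\<^sub>1\<close>. At \<open>y = \<xi>\<^sub>i\<close> the formula gives the
  continuous extension \<open>v(\<xi>\<^sub>i) = u\<^sub>i\<close>.\<close>

definition profile ::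
  "nat \<Rightarrow> (nat \<Rightarrow> real) \<Rightarrow> (nat \<Rightarrow> real) \<Rightarrow> (nat \<Rightarrow> real) \<Rightarrow> real \<Rightarrow> real" where
  "profile m u a \<xi> y =
    (let i = Max {i \<in> {0..m}. bdry m \<xi> i \<le> ereal y} in
      u i + (u (i + 1) - u i) / (F (bdry m \<xi> (i + 1) / ereal (a i)) - F (bdry m \<xi> i / ereal (a i)))
        * (F (ereal y / ereal (a i)) - F (bdry m \<xi> i / ereal (a i))))"

text \<open>\<open>U t x\<close> is the temperature and \<open>x = X i t\<close>, \<open>i \<in> {1..m}\<close>, are the phase transition lines.
  The Riemann data are \<open>u\<^sub>- = u 0\<close> and \<open>u\<^sub>+ = u (m + 1)\<close>. In the Stefan condition \<open>p\<close> and \<open>q\<close> are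
  the limits of \<open>u\<^sub>x\<close> at the line from the warmer and the colder phase; the two conditions
  \<open>\<noteq> bot\<close> exclude vacuous limits.\<close>

definition heat_equation ::
  "nat \<Rightarrow> (nat \<Rightarrow> real) \<Rightarrow> (nat \<Rightarrow> real) \<Rightarrow> (real \<Rightarrow> real \<Rightarrow> real) \<Rightarrow> bool" where
  "heat_equation m u a U \<longleftrightarrow>
    (\<forall>i \<in> {0..m}. \<forall>t > 0. \<forall>x. u i < U t x \<and> U t x < u (i + 1) \<longrightarrow>
      (\<forall>\<^sub>F y in nhds x. U t differentiable (at y)) \<and>
      deriv (U t) differentiable (at x) \<and>
      ((\<lambda>s. U s x) has_real_derivative (a i)\<^sup>2 * deriv (deriv (U t)) x) (at t))"

definition stefan_condition ::
  "nat \<Rightarrow> (nat \<Rightarrow> real) \<Rightarrow> (nat \<Rightarrow> real) \<Rightarrow> (nat \<Rightarrow> real) \<Rightarrow>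
    (real \<Rightarrow> real \<Rightarrow> real) \<Rightarrow> (nat \<Rightarrow> real \<Rightarrow> real) \<Rightarrow> bool" where
  "stefan_condition m u k d U X \<longleftrightarrow>
    (\<forall>i \<in> {1..m}. \<forall>t > 0.
      (let warm = at (X i t) within {x. U t x > u i};
           cold = at (X i t) within {x. U t x < u i}
       in warm \<noteq> bot \<and> cold \<noteq> bot \<and>
          (\<exists>x' p q. (X i has_real_derivative x') (at t) \<and>
             (deriv (U t) \<longlongrightarrow> p) warm \<and> (deriv (U t) \<longlongrightarrow> q) cold \<and>
             d i * x' + k i * p - k (i - 1) * q = 0)))"

definition riemann_data :: "real \<Rightarrow> real \<Rightarrow> (real \<Rightarrow> real \<Rightarrow> real) \<Rightarrow> bool" where
  "riemann_data u_minus u_plus U \<longleftrightarrow>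
    (\<forall>x < 0. ((\<lambda>t. U t x) \<longlongrightarrow> u_minus) (at_right 0)) \<and>
    (\<forall>x > 0. ((\<lambda>t. U t x) \<longlongrightarrow> u_plus) (at_right 0))"

definition stefan_solution ::
  "nat \<Rightarrow> (nat \<Rightarrow> real) \<Rightarrow> (nat \<Rightarrow> real) \<Rightarrow> (nat \<Rightarrow> real) \<Rightarrow> (nat \<Rightarrow> real) \<Rightarrow>
    (real \<Rightarrow> real \<Rightarrow> real) \<Rightarrow> (nat \<Rightarrow> real \<Rightarrow> real) \<Rightarrow> bool" where
  "stefan_solution m u a k d U X \<longleftrightarrow>
    heat_equation m u a U \<and>
    (\<forall>i \<in> {1..m}. \<forall>t > 0. {x. U t x = u i} = {X i t}) \<and>
    stefan_condition m u k d U X \<and>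
    riemann_data (u 0) (u (m + 1)) U"

definition self_similar_solution ::
  "nat \<Rightarrow> (nat \<Rightarrow> real) \<Rightarrow> (nat \<Rightarrow> real) \<Rightarrow> (nat \<Rightarrow> real) \<Rightarrow> (nat \<Rightarrow> real) \<Rightarrow> (nat \<Rightarrow> real) \<Rightarrow> bool" where
  "self_similar_solution m u a k d \<xi> \<longleftrightarrow>
    \<xi> \<in> Omega m \<and>
    stefan_solution m u a k d (\<lambda>t x. profile m u a \<xi> (x / sqrt t)) (\<lambda>i t. \<xi> i * sqrt t)"

definition E ::
  "nat \<Rightarrow> (nat \<Rightarrow> real) \<Rightarrow> (nat \<Rightarrow> real) \<Rightarrow> (nat \<Rightarrow> real) \<Rightarrow> (nat \<Rightarrow> real) \<Rightarrow> (nat \<Rightarrow> real) \<Rightarrow> real" where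
  "E m u a k d \<xi> =
    - (\<Sum>i = 0..m. k i * (u (i + 1) - u i) *
        ln (F (bdry m \<xi> (i + 1) / ereal (a i)) - F (bdry m \<xi> i / ereal (a i))))
    + (\<Sum>i = 1..m. d i * (\<xi> i)\<^sup>2 / 4)"

text \<open>The library's \<open>convex_on\<close> needs a real vector space, which \<open>nat \<Rightarrow> real\<close> is not an instance of.\<close>

definition strictly_convex_on :: "(nat \<Rightarrow> real) set \<Rightarrow> ((nat \<Rightarrow> real) \<Rightarrow> real) \<Rightarrow> bool" where
  "strictly_convex_on S f \<longleftrightarrow>
    (\<forall>x \<in> S. \<forall>y \<in> S. \<forall>r. x \<noteq> y \<and> 0 < r \<and> r < 1 \<longrightarrow>
      (\<lambda>i. (1 - r) * x i + r * y i) \<in> S \<and>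
      f (\<lambda>i. (1 - r) * x i + r * y i) < (1 - r) * f x + r * f y)"

definition coercive_on :: "'a::topological_space set \<Rightarrow> ('a \<Rightarrow> real) \<Rightarrow> bool" where
  "coercive_on S f \<longleftrightarrow> (\<forall>c > 0. compact {x \<in> S. f x \<le> c})"

end

theory Submission
  imports Defs "HOL-Probability.Distributions" "HOL-Probability.Distribution_Functions"
begin

text \<open>The Stefan condition says that \<open>\<partial>E/\<partial>\<xi>\<^sub>i = 0\<close> for all \<open>i\<close>, so the self-similar
  solutions are the critical points of \<open>E\<close>. Writing \<open>D = F y - F x\<close> and \<open>g = F'\<close>, strict concavity of
  \<open>ln (F y - F x)\<close> in \<open>(x, y)\<close> reduces to the two inequalities \<open>g y + y D / 2 > 0\<close> and
  \<open>y g x - x g y - x y D / 2 > 0\<close> for \<open>x < y\<close>. Since \<open>g' s = - s g s / 2\<close>, the first expression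
  has derivative \<open>D / 2\<close> in \<open>y\<close>, and the second has minus the first as its derivative in \<open>x\<close>
  and vanishes at \<open>x = y\<close>. So \<open>E\<close> is strictly convex and a critical point is its unique
  minimum. A minimum exists because every summand of \<open>E\<close> is nonnegative: on a sublevel set each
  difference of values of \<open>F\<close> is then bounded below by a positive constant, which
  confines \<open>\<xi>\<close> to a compact subset of \<open>\<Omega>\<close>.\<close>

section \<open>The Gaussian distribution function\<close>

definition gauss :: "real \<Rightarrow> real" where
  "gauss s = exp (- (s\<^sup>2) / 4) / (2 * sqrt pi)"

lemma gauss_pos [simp]: "gauss s > 0"
  by (simp add: gauss_def)

text \<open>The normal density with mean \<open>0\<close> and variance \<open>2\<close>.
  Integrability and total mass \<open>1\<close> of \<open>gauss\<close> are read off from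
  this.\<close>

lemma normal_density_eq_gauss: "normal_density 0 (sqrt 2) = gauss"
  by (auto simp: fun_eq_iff normal_density_def gauss_def real_sqrt_mult)

lemma has_real_derivative_gauss [derivative_intros]:
  assumes "(f has_real_derivative f') (at x within S)"
  shows "((\<lambda>x. gauss (f x)) has_real_derivative - f x / 2 * gauss (f x) * f') (at x within S)"
proof -
  have "((\<lambda>x. exp (- ((f x)\<^sup>2) / 4)) has_real_derivative
      exp (- ((f x)\<^sup>2) / 4) * (- f x / 2 * f')) (at x within S)"
    by (rule derivative_eq_intros assms refl | simp)+
  from DERIV_cdivide[OF this, of "2 * sqrt pi"] show ?thesis
    unfolding gauss_def by (simp add: ac_simps)
qed

lemma continuous_on_gauss: "continuous_on S gauss"
  unfolding gauss_def by (intro continuous_intros) auto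

lemma set_integrable_gauss: "A \<in> sets borel \<Longrightarrow> set_integrable lborel A gauss"
  unfolding set_integrable_def
  using integrable_mult_indicator[OF _ integrable_normal_density[of "sqrt 2" 0]]
  by (simp add: normal_density_eq_gauss)

lemma F_ereal: "F (ereal x) = (LINT s:{..x}|lborel. gauss s)"
  by (simp add: F_def gauss_def set_lebesgue_integral_def)

lemma F_infty [simp]: "F \<infinity> = 1" "F (-\<infinity>) = 0"
proof -
  show "F \<infinity> = 1" using F_def[of PInfty] by (simp del: infinity_ereal_def add: infinity_ereal_def[symmetric])
  show "F (-\<infinity>) = 0" using F_def[of MInfty] by simp
qed

lemma borel_measurable_gauss [measurable]: "gauss \<in> borel_measurable borel"
  using borel_measurable_normal_density[of 0 "sqrt 2"] by (simp add: normal_density_eq_gauss)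

interpretation gauss: real_distribution "density lborel gauss"
proof -
  interpret prob_space "density lborel gauss"
    using prob_space_normal_density[of "sqrt 2" 0] by (simp add: normal_density_eq_gauss)
  show "real_distribution (density lborel gauss)"
    by unfold_locales auto
qed

text \<open>Gives access to the general facts on distribution functions: the limits \<open>0\<close>
  and \<open>1\<close> at the two ends and the bounds between them.\<close>

lemma F_ereal_eq_cdf: "F (ereal x) = cdf (density lborel gauss) x"
proof -
  have "measure (density lborel gauss) {..x} = (LINT s:{..x}|lborel. gauss s)"
    using integral_density[of "indicator {..x} :: real \<Rightarrow> real" lborel gauss]
    by (simp add: set_lebesgue_integral_def mult.commute less_imp_le)
  then show ?thesis by (simp add: F_ereal cdf_def)
qed

lemma tendsto_F_at_bot: "((\<lambda>x. F (ereal x)) \<longlongrightarrow> 0) at_bot"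
  and tendsto_F_at_top: "((\<lambda>x. F (ereal x)) \<longlongrightarrow> 1) at_top"
  using gauss.cdf_lim_at_bot gauss.cdf_lim_at_top_prob by (simp_all add: F_ereal_eq_cdf)

lemma has_real_derivative_F_at: "((\<lambda>x. F (ereal x)) has_real_derivative gauss x) (at x)"
proof -
  \<comment> \<open>The fundamental theorem of calculus is applied on the compact interval from
    \<open>x - 1\<close> to \<open>x + 1\<close>; since \<open>x\<close> is interior to it, the
    derivative within the interval is the full derivative.\<close>
  have eq: "F (ereal y) = F (ereal (x - 1)) + integral {x - 1..y} gauss" if "y \<ge> x - 1" for y
  proof -
    \<comment> \<open>The two pieces are disjoint. Splitting the integral for
      \<open>F (ereal (x - 1))\<close> at the same point identifies the constant, because the
      integral over a single point vanishes.\<close>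
    have "{..y} = {..<x - 1} \<union> {x - 1..y}" using that by auto
    then have "F (ereal y) = (LINT s:{..<x - 1}|lborel. gauss s) + (LINT s:{x - 1..y}|lborel. gauss s)"
      unfolding F_ereal by (simp only:) (rule set_integral_Un, auto intro: set_integrable_gauss)
    moreover have "(LINT s:{x - 1..y}|lborel. gauss s) = integral {x - 1..y} gauss"
      by (rule set_borel_integral_eq_integral) (simp add: set_integrable_gauss)
    moreover have "{..x - 1} = {..<x - 1} \<union> {x - 1..x - 1}" by auto
    then have "F (ereal (x - 1)) = (LINT s:{..<x - 1}|lborel. gauss s) + (LINT s:{x - 1..x - 1}|lborel. gauss s)"
      unfolding F_ereal by (simp only:) (rule set_integral_Un, auto intro: set_integrable_gauss)
    moreover have "(LINT s:{x - 1..x - 1}|lborel. gauss s) = integral {x - 1..x - 1} gauss"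
      by (rule set_borel_integral_eq_integral) (simp add: set_integrable_gauss)
    ultimately show ?thesis by simp
  qed
  have "((\<lambda>y. F (ereal (x - 1)) + integral {x - 1..y} gauss) has_real_derivative gauss x)
      (at x within {x - 1..x + 1})"
    using DERIV_add[OF DERIV_const[of "F (ereal (x - 1))"] integral_has_real_derivative[OF continuous_on_gauss, of x "x - 1" "x + 1"]]
    by simp
  then have "((\<lambda>y. F (ereal y)) has_real_derivative gauss x) (at x within {x - 1..x + 1})"
    by (rule has_field_derivative_transform_within[OF _ zero_less_one]) (auto simp: eq[symmetric])
  then show ?thesis
    by (simp add: at_within_Icc_at)
qed

lemma has_real_derivative_F [derivative_intros]:
  assumes "(f has_real_derivative f') (at x within S)"
  shows "((\<lambda>x. F (ereal (f x))) has_real_derivative gauss (f x) * f') (at x within S)"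
  by (rule DERIV_chain2[OF has_real_derivative_F_at assms])

lemma continuous_on_F [continuous_intros]:
  assumes "continuous_on S f"
  shows "continuous_on S (\<lambda>x. F (ereal (f x)))"
proof -
  have "continuous_on UNIV (\<lambda>x. F (ereal x))"
    using has_real_derivative_F_at by (auto intro!: continuous_at_imp_continuous_on DERIV_isCont)
  from continuous_on_compose2[OF this assms] show ?thesis by simp
qed

lemma F_strict_mono: "F (ereal x) < F (ereal y) \<longleftrightarrow> x < y"
proof -
  have "F (ereal x) < F (ereal y)" if "x < y" for x y
    by (rule DERIV_pos_imp_increasing[OF that]) (blast intro: has_real_derivative_F_at gauss_pos)
  then show ?thesis by (metis less_asym linorder_cases less_irrefl)
qed

lemma F_bounds: "0 < F (ereal x)" "F (ereal x) < 1"
proof -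
  have "F (ereal (x - 1)) \<ge> 0" "F (ereal (x + 1)) \<le> 1"
    using gauss.cdf_nonneg gauss.cdf_bounded_prob by (auto simp: F_ereal_eq_cdf)
  with F_strict_mono[of "x - 1" x] F_strict_mono[of x "x + 1"]
  show "0 < F (ereal x)" "F (ereal x) < 1" by simp_all
qed

section \<open>Inequalities between the Gaussian density and its interval masses\<close>

lemma gauss_plus_lower_pos:
  assumes "x \<le> y" shows "gauss y + y / 2 * (F (ereal y) - F (ereal x)) > 0"
proof -
  let ?h = "\<lambda>y. gauss y + y / 2 * (F (ereal y) - F (ereal x))"
  have "?h x \<le> ?h y"
  proof (rule DERIV_nonneg_imp_nondecreasing[OF assms])
    fix t assume t: "x \<le> t" "t \<le> y"
    have "(?h has_real_derivative (F (ereal t) - F (ereal x)) / 2) (at t)"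
      by (rule derivative_eq_intros refl | simp)+
    moreover have "F (ereal t) - F (ereal x) \<ge> 0"
      using t F_strict_mono[of x t] by (cases "x = t") auto
    ultimately show "\<exists>D. (?h has_real_derivative D) (at t) \<and> 0 \<le> D"
      by (intro exI[of _ "(F (ereal t) - F (ereal x)) / 2"]) auto
  qed
  with gauss_pos[of x] show ?thesis by (simp del: gauss_pos)
qed

text \<open>Mirror image of \<open>gauss_plus_lower_pos\<close> under the reflection that sends
  \<open>(x, y)\<close> to \<open>(- y, - x)\<close>: the density is even and the mass of the
  interval is preserved.\<close>

lemma gauss_minus_upper_pos:
  assumes "x \<le> y" shows "gauss x - x / 2 * (F (ereal y) - F (ereal x)) > 0"
proof -
  let ?h = "\<lambda>x. gauss x - x / 2 * (F (ereal y) - F (ereal x))"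
  have "?h y \<le> ?h x"
  proof (rule DERIV_nonpos_imp_nonincreasing[OF assms])
    fix t assume t: "x \<le> t" "t \<le> y"
    have "(?h has_real_derivative - (F (ereal y) - F (ereal t)) / 2) (at t)"
      by (rule derivative_eq_intros refl | simp add: field_simps)+
    moreover have "F (ereal y) - F (ereal t) \<ge> 0"
      using t F_strict_mono[of t y] by (cases "t = y") auto
    ultimately show "\<exists>D. (?h has_real_derivative D) (at t) \<and> D \<le> 0"
      by (intro exI[of _ "- (F (ereal y) - F (ereal t)) / 2"]) auto
  qed
  with gauss_pos[of y] show ?thesis by (simp del: gauss_pos)
qed

text \<open>Letting \<open>x\<close> tend to minus infinity in \<open>gauss_plus_lower_pos\<close>
  yields only a weak inequality. It becomes strict because the expression is strictly increasing in
  \<open>y\<close>, with derivative \<open>F (ereal y) / 2\<close>.\<close>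

lemma gauss_plus_mills_pos: "gauss y + y / 2 * F (ereal y) > 0"
proof -
  let ?h = "\<lambda>y. gauss y + y / 2 * F (ereal y)"
  have nonneg: "?h y \<ge> 0" for y
  proof (rule tendsto_lowerbound)
    show "((\<lambda>x. gauss y + y / 2 * (F (ereal y) - F (ereal x))) \<longlongrightarrow> ?h y) at_bot"
      by (rule tendsto_eq_intros tendsto_F_at_bot refl | simp)+
    show "\<forall>\<^sub>F x in at_bot. 0 \<le> gauss y + y / 2 * (F (ereal y) - F (ereal x))"
      using eventually_le_at_bot[of y]
      by eventually_elim (use gauss_plus_lower_pos in \<open>auto intro: less_imp_le\<close>)
  qed simp
  have "?h (y - 1) < ?h y"
  proof (rule DERIV_pos_imp_increasing[where f = ?h])
    fix t
    have "(?h has_real_derivative F (ereal t) / 2) (at t)"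
      by (rule derivative_eq_intros refl | simp)+
    then show "\<exists>D. (?h has_real_derivative D) (at t) \<and> 0 < D"
      using F_bounds(1)[of t] by (intro exI[of _ "F (ereal t) / 2"]) auto
  qed simp
  with nonneg[of "y - 1"] show ?thesis by linarith
qed

text \<open>The same argument at plus infinity: the limit of \<open>gauss_minus_upper_pos\<close> is
  made strict by strict decrease in \<open>x\<close>.\<close>

lemma gauss_minus_mills_pos: "gauss x - x / 2 * (1 - F (ereal x)) > 0"
proof -
  let ?h = "\<lambda>x. gauss x - x / 2 * (1 - F (ereal x))"
  have nonneg: "?h x \<ge> 0" for x
  proof (rule tendsto_lowerbound)
    show "((\<lambda>y. gauss x - x / 2 * (F (ereal y) - F (ereal x))) \<longlongrightarrow> ?h x) at_top"
      by (rule tendsto_eq_intros tendsto_F_at_top refl | simp)+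
    show "\<forall>\<^sub>F y in at_top. 0 \<le> gauss x - x / 2 * (F (ereal y) - F (ereal x))"
      using eventually_ge_at_top[of x]
      by eventually_elim (use gauss_minus_upper_pos in \<open>auto intro: less_imp_le\<close>)
  qed simp
  have "?h (x + 1) < ?h x"
  proof (rule DERIV_neg_imp_decreasing[where f = ?h])
    fix t
    have "(?h has_real_derivative - (1 - F (ereal t)) / 2) (at t)"
      by (rule derivative_eq_intros refl | simp add: field_simps)+
    then show "\<exists>D. (?h has_real_derivative D) (at t) \<and> D < 0"
      using F_bounds(2)[of t] by (intro exI[of _ "- (1 - F (ereal t)) / 2"]) auto
  qed simp
  with nonneg[of "x + 1"] show ?thesis by linarith
qed

text \<open>Up to a positive factor this expression is the determinant of the quadratic form in
  \<open>log_concavity_interior\<close>.\<close>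

lemma gauss_cross_pos:
  assumes "x < y"
  shows "y * gauss x - x * gauss y - x * y / 2 * (F (ereal y) - F (ereal x)) > 0"
proof -
  let ?h = "\<lambda>x. y * gauss x - x * gauss y - x * y / 2 * (F (ereal y) - F (ereal x))"
  have "?h y < ?h x"
  proof (rule DERIV_neg_imp_decreasing_open[OF assms])
    fix t assume t: "x < t" "t < y"
    have "(?h has_real_derivative - (gauss y + y / 2 * (F (ereal y) - F (ereal t)))) (at t)"
      by (rule derivative_eq_intros refl | simp add: field_simps)+
    then show "\<exists>D. (?h has_real_derivative D) (at t) \<and> D < 0"
      using gauss_plus_lower_pos[of t y] t by (intro exI conjI) auto
  next
    show "continuous_on {x..y} ?h"
      by (intro continuous_intros continuous_on_gauss) auto
  qed
  then show ?thesis by simp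
qed

subsection \<open>Strict log-concavity of Gaussian interval masses\<close>

text \<open>Positive definiteness of a two-by-two form from its leading coefficient and determinant,
  by completing the square after multiplication with \<alpha>.\<close>

lemma quadratic_form_pos:
  fixes \<alpha> \<beta> \<gamma> p q :: real
  assumes "\<alpha> > 0" "\<alpha> * \<gamma> > \<beta>\<^sup>2" "p \<noteq> 0 \<or> q \<noteq> 0"
  shows "\<alpha> * q\<^sup>2 - 2 * \<beta> * p * q + \<gamma> * p\<^sup>2 > 0"
proof -
  have "\<alpha> * (\<alpha> * q\<^sup>2 - 2 * \<beta> * p * q + \<gamma> * p\<^sup>2) = (\<alpha> * q - \<beta> * p)\<^sup>2 + (\<alpha> * \<gamma> - \<beta>\<^sup>2) * p\<^sup>2"
    by (simp add: power2_eq_square algebra_simps)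
  also have "\<dots> > 0"
    using assms by (cases "p = 0") (auto intro!: add_nonneg_pos)
  finally show ?thesis using \<open>\<alpha> > 0\<close> by (simp add: zero_less_mult_iff)
qed

text \<open>For \<open>D t = F (y + t * q) - F (x + t * p)\<close> the left-hand side is
  \<open>D'^2 - D * D''\<close> at \<open>t = 0\<close>, that is, \<open>- D^2\<close> times the
  second derivative of \<open>ln D\<close>.\<close>

lemma log_concavity_interior:
  assumes "x < y" "p \<noteq> 0 \<or> q \<noteq> 0"
  shows "(gauss y * q - gauss x * p)\<^sup>2 -
    (F (ereal y) - F (ereal x)) * (x / 2 * gauss x * p\<^sup>2 - y / 2 * gauss y * q\<^sup>2) > 0"
proof -
  define D where "D = F (ereal y) - F (ereal x)"
  \<comment> \<open>The expression is a quadratic form in \<open>(p, q)\<close>: \<alpha> is the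
    coefficient of the square of \<open>q\<close>, \<gamma> that of the square of \<open>p\<close>,
    and \<open>- 2 * \<beta>\<close> that of \<open>p * q\<close>.\<close>
  define \<alpha> where "\<alpha> = gauss y * (gauss y + y / 2 * D)"
  define \<beta> where "\<beta> = gauss x * gauss y"
  define \<gamma> where "\<gamma> = gauss x * (gauss x - x / 2 * D)"
  have D: "D > 0" using assms F_strict_mono by (simp add: D_def)
  have "\<alpha> > 0" using gauss_plus_lower_pos[of x y] assms by (simp add: \<alpha>_def D_def)
  moreover have "\<alpha> * \<gamma> - \<beta>\<^sup>2 = gauss x * gauss y * (D / 2) * (y * gauss x - x * gauss y - x * y / 2 * D)"
    by (simp add: \<alpha>_def \<beta>_def \<gamma>_def power2_eq_square field_simps)
  moreover have "gauss x * gauss y * (D / 2) * (y * gauss x - x * gauss y - x * y / 2 * D) > 0"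
    using D gauss_cross_pos[OF assms(1)] by (intro mult_pos_pos) (auto simp: D_def)
  ultimately have "\<alpha> * q\<^sup>2 - 2 * \<beta> * p * q + \<gamma> * p\<^sup>2 > 0"
    using assms(2) by (intro quadratic_form_pos) auto
  then show ?thesis
    by (simp add: \<alpha>_def \<beta>_def \<gamma>_def D_def power2_eq_square field_simps)
qed

text \<open>The degenerate case of an interval starting at minus infinity: only the right end moves,
  so the form has a single variable and factors.\<close>

lemma log_concavity_lower:
  assumes "q \<noteq> 0"
  shows "(gauss y * q)\<^sup>2 + F (ereal y) * (y / 2 * gauss y * q\<^sup>2) > 0"
proof -
  have "(gauss y * q)\<^sup>2 + F (ereal y) * (y / 2 * gauss y * q\<^sup>2)
      = gauss y * q\<^sup>2 * (gauss y + y / 2 * F (ereal y))"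
    by (simp add: power2_eq_square algebra_simps)
  with gauss_plus_mills_pos[of y] assms show ?thesis by simp
qed

text \<open>The counterpart for an interval reaching to plus infinity, where only the left end
  moves.\<close>

lemma log_concavity_upper:
  assumes "p \<noteq> 0"
  shows "(gauss x * p)\<^sup>2 - (1 - F (ereal x)) * (x / 2 * gauss x * p\<^sup>2) > 0"
proof -
  have "(gauss x * p)\<^sup>2 - (1 - F (ereal x)) * (x / 2 * gauss x * p\<^sup>2)
      = gauss x * p\<^sup>2 * (gauss x - x / 2 * (1 - F (ereal x)))"
    by (simp add: power2_eq_square algebra_simps)
  with gauss_minus_mills_pos[of x] assms show ?thesis by simp
qed

section \<open>Convexity of the energy\<close>

text \<open>The scale \<open>c\<close> is independent of \<open>j\<close> because the point
  \<open>\<xi> j\<close> enters with \<open>a j\<close> in the phase on its right and with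
  \<open>a (j - 1)\<close> in the phase on its left.\<close>

definition F_at :: "nat \<Rightarrow> real \<Rightarrow> (nat \<Rightarrow> real) \<Rightarrow> nat \<Rightarrow> real" where
  "F_at m c \<xi> j = F (bdry m \<xi> j / ereal c)"

text \<open>The value \<open>0\<close> at the infinite endpoints \<open>j = 0\<close> and \<open>j = m + 1\<close> lets the two outer phases be
  treated like the inner ones.\<close>

definition gauss_at :: "nat \<Rightarrow> real \<Rightarrow> (nat \<Rightarrow> real) \<Rightarrow> nat \<Rightarrow> real" where
  "gauss_at m c \<xi> j = (if j \<in> {1..m} then gauss (\<xi> j / c) else 0)"

definition gap :: "nat \<Rightarrow> (nat \<Rightarrow> real) \<Rightarrow> (nat \<Rightarrow> real) \<Rightarrow> nat \<Rightarrow> real" where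
  "gap m a \<xi> i = F_at m (a i) \<xi> (i + 1) - F_at m (a i) \<xi> i"

text \<open>The derivative of \<open>gap\<close> in the direction \<open>v\<close>;
  \<open>gap''\<close> is the second derivative in the same direction.\<close>

definition gap' :: "nat \<Rightarrow> (nat \<Rightarrow> real) \<Rightarrow> (nat \<Rightarrow> real) \<Rightarrow> (nat \<Rightarrow> real) \<Rightarrow> nat \<Rightarrow> real" where
  "gap' m a \<xi> v i =
    gauss_at m (a i) \<xi> (i + 1) * (v (i + 1) / a i) - gauss_at m (a i) \<xi> i * (v i / a i)"

definition gap'' :: "nat \<Rightarrow> (nat \<Rightarrow> real) \<Rightarrow> (nat \<Rightarrow> real) \<Rightarrow> (nat \<Rightarrow> real) \<Rightarrow> nat \<Rightarrow> real" where
  "gap'' m a \<xi> v i =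
    \<xi> i / a i / 2 * gauss_at m (a i) \<xi> i * (v i / a i)\<^sup>2
    - \<xi> (i + 1) / a i / 2 * gauss_at m (a i) \<xi> (i + 1) * (v (i + 1) / a i)\<^sup>2"

text \<open>Functions of tuples are differentiated only along such lines, so that one-variable
  calculus suffices.\<close>

definition line :: "(nat \<Rightarrow> real) \<Rightarrow> (nat \<Rightarrow> real) \<Rightarrow> real \<Rightarrow> nat \<Rightarrow> real" where
  "line \<xi> v t = (\<lambda>i. \<xi> i + t * v i)"

lemma F_at_eq:
  "c > 0 \<Longrightarrow> F_at m c \<xi> j = (if j = 0 then 0 else if j \<le> m then F (ereal (\<xi> j / c)) else 1)"
  by (simp add: F_at_def bdry_def)

lemma OmegaD: "\<xi> \<in> Omega m \<Longrightarrow> 1 \<le> i \<Longrightarrow> i < j \<Longrightarrow> j \<le> m \<Longrightarrow> \<xi> i < \<xi> j"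
  by (auto simp: Omega_def strict_mono_on_def)

lemma Omega_vanish: "\<xi> \<in> Omega m \<Longrightarrow> i \<notin> {1..m} \<Longrightarrow> \<xi> i = 0"
  by (auto simp: Omega_def)

lemma OmegaI:
  assumes "\<And>i. i \<notin> {1..m} \<Longrightarrow> \<xi> i = 0" and step: "\<And>i. 1 \<le> i \<Longrightarrow> i < m \<Longrightarrow> \<xi> i < \<xi> (i + 1)"
  shows "\<xi> \<in> Omega m"
proof -
  have "\<xi> i < \<xi> j" if "1 \<le> i" "i < j" "j \<le> m" for i j
    using that(2,3)
  proof (induction j)
    case (Suc j)
    show ?case
    proof (cases "i = j")
      case False
      then have "\<xi> i < \<xi> j" using Suc by simp
      also have "\<xi> j < \<xi> (j + 1)" using Suc.prems \<open>1 \<le> i\<close> by (intro step) auto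
      finally show ?thesis by simp
    qed (use step Suc.prems \<open>1 \<le> i\<close> in auto)
  qed simp
  then show ?thesis using assms(1) by (auto simp: Omega_def strict_mono_on_def)
qed

lemma gap_pos:
  assumes "\<xi> \<in> Omega m" "i \<le> m" "a i > 0"
  shows "gap m a \<xi> i > 0"
  using assms OmegaD[of \<xi> m i "i + 1"] F_bounds
  by (auto simp: gap_def F_at_eq F_strict_mono divide_strict_right_mono)

lemma gap_le_1:
  assumes "i \<le> m" "a i > 0"
  shows "gap m a \<xi> i \<le> 1"
proof -
  have "F_at m (a i) \<xi> (i + 1) \<le> 1" "F_at m (a i) \<xi> i \<ge> 0"
    using assms F_bounds by (auto simp: F_at_eq less_imp_le)
  then show ?thesis by (simp add: gap_def)
qed

section \<open>Derivatives of the gaps along a line\<close>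

lemma has_real_derivative_F_at_line:
  assumes "c > 0"
  shows "((\<lambda>t. F_at m c (line \<xi> v t) j) has_real_derivative gauss_at m c (line \<xi> v t) j * (v j / c)) (at t)"
  using assms unfolding F_at_eq[OF assms] gauss_at_def line_def
  by (auto intro!: derivative_eq_intros)

lemma has_real_derivative_gauss_at_line:
  assumes "c > 0"
  shows "((\<lambda>t. gauss_at m c (line \<xi> v t) j) has_real_derivative
    - (line \<xi> v t j / c) / 2 * gauss_at m c (line \<xi> v t) j * (v j / c)) (at t)"
  using assms unfolding gauss_at_def line_def
  by (auto intro!: derivative_eq_intros)

lemma has_real_derivative_gap_line:
  assumes "a i > 0"
  shows "((\<lambda>t. gap m a (line \<xi> v t) i) has_real_derivative gap' m a (line \<xi> v t) v i) (at t)"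
  unfolding gap_def gap'_def by (intro DERIV_diff has_real_derivative_F_at_line assms)

lemma has_real_derivative_gap'_line:
  assumes "a i > 0"
  shows "((\<lambda>t. gap' m a (line \<xi> v t) v i) has_real_derivative gap'' m a (line \<xi> v t) v i) (at t)"
proof -
  note [derivative_intros] = has_real_derivative_gauss_at_line[OF assms]
  show ?thesis unfolding gap''_def gap'_def
    by (rule derivative_eq_intros refl)+ (simp add: power2_eq_square algebra_simps)
qed

lemma gap_log_concave:
  assumes "\<xi> \<in> Omega m" "i \<le> m" "a i > 0" "\<And>j. j \<notin> {1..m} \<Longrightarrow> v j = 0"
    and "v i \<noteq> 0 \<or> v (i + 1) \<noteq> 0"
  shows "(gap' m a \<xi> v i)\<^sup>2 - gap m a \<xi> i * gap'' m a \<xi> v i > 0"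
proof -
  \<comment> \<open>The left end is fixed for phase \<open>0\<close>, the right end for phase
    \<open>m\<close>, and both ends move otherwise. A phase with \<open>i = 0 = m\<close> cannot
    occur: \<open>v\<close> would vanish at both of its ends.\<close>
  consider "i = 0" "i < m" | "i = m" "0 < i" | "0 < i" "i < m"
    using assms(2,4,5) by (cases "i = 0"; cases "i = m") force+
  then show ?thesis
  proof cases
    case 1
    then have "v 0 = 0" using assms(4) by simp
    then have "v 1 / a i \<noteq> 0" using assms 1 by auto
    from log_concavity_lower[OF this, of "\<xi> 1 / a i"] show ?thesis
      using 1 assms(3) \<open>v 0 = 0\<close> by (simp add: gap_def gap'_def gap''_def F_at_eq gauss_at_def)
  next
    case 2
    then have "v (m + 1) = 0" using assms(4) by simp
    then have "v m / a i \<noteq> 0" using assms 2 by auto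
    from log_concavity_upper[OF this, of "\<xi> m / a i"] show ?thesis
      using 2 assms(3) \<open>v (m + 1) = 0\<close> by (simp add: gap_def gap'_def gap''_def F_at_eq gauss_at_def)
  next
    case 3
    then have "\<xi> i / a i < \<xi> (i + 1) / a i"
      using OmegaD[OF assms(1), of i "i + 1"] assms(3) by (simp add: divide_strict_right_mono)
    moreover have "v i / a i \<noteq> 0 \<or> v (i + 1) / a i \<noteq> 0" using assms by auto
    ultimately show ?thesis
      using log_concavity_interior[of "\<xi> i / a i" "\<xi> (i + 1) / a i" "v i / a i" "v (i + 1) / a i"] 3 assms(3)
      by (simp add: gap_def gap'_def gap''_def F_at_eq gauss_at_def)
  qed
qed

text \<open>The mean value theorem turns the difference quotients on \<open>[0, r]\<close> and
  \<open>[r, 1]\<close> into values of \<open>f'\<close>, and \<open>f'\<close> is strictly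
  increasing.\<close>

lemma less_convex_comb_of_second_derivative_pos:
  fixes f f' f'' :: "real \<Rightarrow> real"
  assumes f: "\<And>t. 0 \<le> t \<Longrightarrow> t \<le> 1 \<Longrightarrow> (f has_real_derivative f' t) (at t)"
    and f': "\<And>t. 0 \<le> t \<Longrightarrow> t \<le> 1 \<Longrightarrow> (f' has_real_derivative f'' t) (at t)"
    and pos: "\<And>t. 0 \<le> t \<Longrightarrow> t \<le> 1 \<Longrightarrow> f'' t > 0"
    and r: "0 < r" "r < 1"
  shows "f r < (1 - r) * f 0 + r * f 1"
proof -
  have mono: "f' s < f' t" if "0 \<le> s" "s < t" "t \<le> 1" for s t
    using that by (intro DERIV_pos_imp_increasing[OF that(2)]) (meson f' pos order_trans)
  obtain s where s: "0 < s" "s < r" "f r - f 0 = (r - 0) * f' s"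
    using r MVT2[of 0 r f f'] f by auto
  obtain t where t: "r < t" "t < 1" "f 1 - f r = (1 - r) * f' t"
    using r MVT2[of r 1 f f'] f by auto
  have "(1 - r) * r * f' s < (1 - r) * r * f' t"
    using mono[of s t] s t r by simp
  moreover have "(1 - r) * (f r - f 0) = (1 - r) * r * f' s" "r * (f 1 - f r) = (1 - r) * r * f' t"
    using s t by auto
  ultimately have "(1 - r) * (f r - f 0) < r * (f 1 - f r)" by linarith
  then show ?thesis by (simp add: algebra_simps)
qed

text \<open>By the mean value theorem the increment is a value of \<open>f'\<close> at an interior
  point, and this exceeds \<open>f' 0 = 0\<close>.\<close>

lemma less_of_second_derivative_pos:
  fixes f f' f'' :: "real \<Rightarrow> real"
  assumes f: "\<And>t. 0 \<le> t \<Longrightarrow> t \<le> 1 \<Longrightarrow> (f has_real_derivative f' t) (at t)"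
    and f': "\<And>t. 0 \<le> t \<Longrightarrow> t \<le> 1 \<Longrightarrow> (f' has_real_derivative f'' t) (at t)"
    and pos: "\<And>t. 0 \<le> t \<Longrightarrow> t \<le> 1 \<Longrightarrow> f'' t > 0"
    and "f' 0 = 0"
  shows "f 0 < f 1"
proof -
  obtain t where t: "0 < t" "t < 1" "f 1 - f 0 = (1 - 0) * f' t"
    using MVT2[of 0 1 f f'] f by auto
  moreover have "f' 0 < f' t"
    using t by (intro DERIV_pos_imp_increasing[of 0 t f']) (auto, meson f' pos order_trans less_imp_le)
  ultimately show ?thesis using \<open>f' 0 = 0\<close> by simp
qed

section \<open>The energy and its directional derivatives\<close>

locale stefan_data =
  fixes m :: nat and u a k d :: "nat \<Rightarrow> real"
  assumes u: "\<And>i. i \<le> m \<Longrightarrow> u i < u (i + 1)"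
    and a: "\<And>i. i \<le> m \<Longrightarrow> a i > 0"
    and k: "\<And>i. i \<le> m \<Longrightarrow> k i > 0"
    and d: "\<And>i. i \<in> {1..m} \<Longrightarrow> d i \<ge> 0"
begin

abbreviation energy :: "(nat \<Rightarrow> real) \<Rightarrow> real" where
  "energy \<equiv> E m u a k d"

definition weight :: "nat \<Rightarrow> real" where
  "weight i = k i * (u (i + 1) - u i)"

text \<open>The derivative of the energy at \<xi> in the direction \<open>v\<close>;
  \<open>energy''\<close> is the second derivative in that direction.\<close>

definition energy' :: "(nat \<Rightarrow> real) \<Rightarrow> (nat \<Rightarrow> real) \<Rightarrow> real" where
  "energy' \<xi> v = - (\<Sum>i = 0..m. weight i * (gap' m a \<xi> v i / gap m a \<xi> i))
    + (\<Sum>i = 1..m. d i * \<xi> i * v i / 2)"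

definition energy'' :: "(nat \<Rightarrow> real) \<Rightarrow> (nat \<Rightarrow> real) \<Rightarrow> real" where
  "energy'' \<xi> v =
    (\<Sum>i = 0..m. weight i * (((gap' m a \<xi> v i)\<^sup>2 - gap m a \<xi> i * gap'' m a \<xi> v i) / (gap m a \<xi> i)\<^sup>2))
    + (\<Sum>i = 1..m. d i * (v i)\<^sup>2 / 2)"

text \<open>The left-hand side of the algebraic system that is equivalent to the Stefan condition.\<close>

definition residual :: "(nat \<Rightarrow> real) \<Rightarrow> nat \<Rightarrow> real" where
  "residual \<xi> i = d i * \<xi> i / 2 + weight i / gap m a \<xi> i * gauss (\<xi> i / a i) / a i
    - weight (i - 1) / gap m a \<xi> (i - 1) * gauss (\<xi> i / a (i - 1)) / a (i - 1)"

lemma weight_pos: "i \<le> m \<Longrightarrow> weight i > 0"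
  using u[of i] k[of i] by (simp add: weight_def)

lemma energy_eq:
  "energy \<xi> = - (\<Sum>i = 0..m. weight i * ln (gap m a \<xi> i)) + (\<Sum>i = 1..m. d i * (\<xi> i)\<^sup>2 / 4)"
  by (simp add: E_def weight_def gap_def F_at_def)

lemma has_real_derivative_energy_line:
  assumes "line \<xi> v t \<in> Omega m"
  shows "((\<lambda>t. energy (line \<xi> v t)) has_real_derivative energy' (line \<xi> v t) v) (at t)"
proof -
  have "((\<lambda>t. weight i * ln (gap m a (line \<xi> v t) i)) has_real_derivative
      weight i * (gap' m a (line \<xi> v t) v i / gap m a (line \<xi> v t) i)) (at t)" if "i \<le> m" for i
    using that gap_pos[OF assms that, of a] a has_real_derivative_gap_line[of a i]
    by (auto intro!: derivative_eq_intros)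
  moreover have "((\<lambda>t. d i * (line \<xi> v t i)\<^sup>2 / 4) has_real_derivative
      d i * line \<xi> v t i * v i / 2) (at t)" for i
    unfolding line_def by (rule derivative_eq_intros refl | simp add: field_simps)+
  ultimately show ?thesis
    unfolding energy_eq energy'_def by (intro DERIV_add DERIV_minus DERIV_sum) auto
qed

lemma has_real_derivative_energy'_line:
  assumes "line \<xi> v t \<in> Omega m"
  shows "((\<lambda>t. energy' (line \<xi> v t) v) has_real_derivative energy'' (line \<xi> v t) v) (at t)"
proof -
  have "((\<lambda>t. weight i * (gap' m a (line \<xi> v t) v i / gap m a (line \<xi> v t) i)) has_real_derivative
      - (weight i * (((gap' m a (line \<xi> v t) v i)\<^sup>2 -
        gap m a (line \<xi> v t) i * gap'' m a (line \<xi> v t) v i) / (gap m a (line \<xi> v t) i)\<^sup>2))) (at t)"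
    if "i \<le> m" for i
  proof -
    have "gap m a (line \<xi> v t) i \<noteq> 0" using gap_pos[OF assms that, of a] a[OF that] by simp
    from DERIV_cmult[OF DERIV_divide[OF has_real_derivative_gap'_line[of a i m \<xi> v t, OF a[OF that]]
        has_real_derivative_gap_line[of a i m \<xi> v t, OF a[OF that]] this], of "weight i"]
    show ?thesis by (simp add: power2_eq_square minus_divide_left algebra_simps)
  qed
  then have "((\<lambda>t. - (\<Sum>i = 0..m. weight i * (gap' m a (line \<xi> v t) v i / gap m a (line \<xi> v t) i)))
    has_real_derivative - (\<Sum>i = 0..m. - (weight i * (((gap' m a (line \<xi> v t) v i)\<^sup>2 -
        gap m a (line \<xi> v t) i * gap'' m a (line \<xi> v t) v i) / (gap m a (line \<xi> v t) i)\<^sup>2)))) (at t)"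
    by (intro DERIV_minus DERIV_sum) auto
  moreover have "((\<lambda>t. (\<Sum>i = 1..m. d i * line \<xi> v t i * v i / 2)) has_real_derivative
      (\<Sum>i = 1..m. d i * (v i)\<^sup>2 / 2)) (at t)"
    unfolding line_def
    by (intro DERIV_sum) (rule derivative_eq_intros refl | simp add: power2_eq_square)+
  ultimately show ?thesis
    unfolding energy'_def energy''_def
    using DERIV_add by (fastforce simp: sum_negf)
qed

text \<open>All summands are nonnegative. Since \<open>d\<close> may vanish, strictness is taken
  from the logarithmic terms: a phase with a moving end contributes a positive amount by
  \<open>gap_log_concave\<close>.\<close>

lemma energy''_pos:
  assumes "\<xi> \<in> Omega m" "\<And>j. j \<notin> {1..m} \<Longrightarrow> v j = 0" "v \<noteq> (\<lambda>_. 0)"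
  shows "energy'' \<xi> v > 0"
proof -
  let ?t = "\<lambda>i. weight i * (((gap' m a \<xi> v i)\<^sup>2 - gap m a \<xi> i * gap'' m a \<xi> v i) / (gap m a \<xi> i)\<^sup>2)"
  have pos: "?t i > 0" if "i \<le> m" "v i \<noteq> 0 \<or> v (i + 1) \<noteq> 0" for i
    using gap_log_concave[of \<xi> m i a v] assms(1,2) that a[OF that(1)]
      weight_pos[OF that(1)] gap_pos[OF assms(1) that(1), of a]    by simp
  have nonneg: "?t i \<ge> 0" if "i \<le> m" for i
  proof (cases "v i \<noteq> 0 \<or> v (i + 1) \<noteq> 0")
    \<comment> \<open>Both ends are at rest, so the two derivatives of the gap are zero.\<close>
    case False
    then show ?thesis by (simp add: gap'_def gap''_def)
  qed (use pos that in \<open>auto intro: less_imp_le\<close>)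
  obtain i where "v i \<noteq> 0" using assms(3) by auto
  then have "i \<in> {0..m}" using assms(2) by force
  then have "(\<Sum>i = 0..m. ?t i) > 0"
    using pos[of i] nonneg \<open>v i \<noteq> 0\<close> by (intro sum_pos2[of _ i]) auto
  moreover have "(\<Sum>i = 1..m. d i * (v i)\<^sup>2 / 2) \<ge> 0"
    using d by (intro sum_nonneg) auto
  ultimately show ?thesis unfolding energy''_def by linarith
qed

text \<open>Summation by parts: the sum over phases is regrouped into a sum over interfaces. Hence
  the residuals are the partial derivatives of the energy.\<close>

lemma energy'_eq_residual: "energy' \<xi> v = (\<Sum>i = 1..m. residual \<xi> i * v i)"
proof -
  define q where "q i = weight i / gap m a \<xi> i / a i" for i
  have "(\<Sum>i = 0..m. weight i * (gap' m a \<xi> v i / gap m a \<xi> i)) =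
      (\<Sum>i = 0..m. q i * gauss_at m (a i) \<xi> (i + 1) * v (i + 1)) -
      (\<Sum>i = 0..m. q i * gauss_at m (a i) \<xi> i * v i)"
    unfolding sum_subtractf[symmetric]
    by (intro sum.cong refl) (simp add: gap'_def q_def diff_divide_distrib algebra_simps)
  also have "(\<Sum>i = 0..m. q i * gauss_at m (a i) \<xi> i * v i) =
      (\<Sum>i = 1..m. q i * gauss (\<xi> i / a i) * v i)"
    by (simp add: sum.atLeast_Suc_atMost gauss_at_def)
  \<comment> \<open>The shift makes interface \<open>i\<close> the right end of phase
    \<open>i - 1\<close>. The extra term \<open>i = m + 1\<close> drops out because
    \<open>gauss_at\<close> is \<open>0\<close> there, just as the term \<open>i = 0\<close> did in
    the other sum.\<close>
  also have "(\<Sum>i = 0..m. q i * gauss_at m (a i) \<xi> (i + 1) * v (i + 1)) =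
      (\<Sum>i = 1..m + 1. q (i - 1) * gauss_at m (a (i - 1)) \<xi> i * v i)"
    using sum.shift_bounds_cl_nat_ivl[of "\<lambda>i. q (i - 1) * gauss_at m (a (i - 1)) \<xi> i * v i" 0 1 m] by simp
  also have "\<dots> = (\<Sum>i = 1..m. q (i - 1) * gauss (\<xi> i / a (i - 1)) * v i)"
    by (simp add: gauss_at_def)
  finally show ?thesis
    unfolding energy'_def residual_def
    by (simp add: q_def sum.distrib sum_subtractf algebra_simps)
qed

section \<open>Strict convexity and its consequence for critical points\<close>

lemma line_diff_in_Omega:
  assumes "\<xi> \<in> Omega m" "\<eta> \<in> Omega m" "0 \<le> t" "t \<le> 1"
  shows "line \<xi> (\<lambda>i. \<eta> i - \<xi> i) t \<in> Omega m"
proof (rule OmegaI)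
  fix i assume "1 \<le> i" "i < m"
  then have *: "\<xi> i < \<xi> (i + 1)" "\<eta> i < \<eta> (i + 1)" using assms OmegaD by auto
  have "(1 - t) * \<xi> i + t * \<eta> i < (1 - t) * \<xi> (i + 1) + t * \<eta> (i + 1)"
  \<comment> \<open>For \<open>t > 0\<close> the \<eta> terms give the strict inequality; at
    \<open>t = 0\<close> only the \<xi> terms remain.\<close>
  proof (cases "t = 0")
    case False
    then show ?thesis using * assms(3,4)
      by (intro add_le_less_mono mult_left_mono mult_strict_left_mono) auto
  qed (use * in simp)
  then show "line \<xi> (\<lambda>i. \<eta> i - \<xi> i) t i < line \<xi> (\<lambda>i. \<eta> i - \<xi> i) t (i + 1)"
    by (simp add: line_def algebra_simps)
qed (use assms in \<open>simp add: line_def Omega_vanish\<close>)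

lemma line_endpoints: "line \<xi> v 0 = \<xi>" "line \<xi> (\<lambda>i. \<eta> i - \<xi> i) 1 = \<eta>"
  by (auto simp: line_def)

lemma energy''_line_pos:
  assumes "\<xi> \<in> Omega m" "\<eta> \<in> Omega m" "\<xi> \<noteq> \<eta>" "0 \<le> t" "t \<le> 1"
  shows "energy'' (line \<xi> (\<lambda>i. \<eta> i - \<xi> i) t) (\<lambda>i. \<eta> i - \<xi> i) > 0"
proof (intro energy''_pos line_diff_in_Omega)
  show "(\<lambda>i. \<eta> i - \<xi> i) \<noteq> (\<lambda>_. 0)"
    using assms(3) by (metis ext eq_iff_diff_eq_0)
qed (use assms in \<open>auto simp: Omega_vanish\<close>)

lemma strictly_convex_energy: "strictly_convex_on (Omega m) energy"
  unfolding strictly_convex_on_def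
proof (intro ballI allI impI conjI; elim conjE)
  fix \<xi> \<eta> and r :: real
  assume *: "\<xi> \<in> Omega m" "\<eta> \<in> Omega m" "\<xi> \<noteq> \<eta>" "0 < r" "r < 1"
  let ?v = "\<lambda>i. \<eta> i - \<xi> i"
  have eq: "(\<lambda>i. (1 - r) * \<xi> i + r * \<eta> i) = line \<xi> ?v r"
    by (simp add: line_def algebra_simps)
  show "(\<lambda>i. (1 - r) * \<xi> i + r * \<eta> i) \<in> Omega m"
    unfolding eq using * by (intro line_diff_in_Omega) auto
  have "energy (line \<xi> ?v r) < (1 - r) * energy (line \<xi> ?v 0) + r * energy (line \<xi> ?v 1)"
    using *
    by (intro less_convex_comb_of_second_derivative_pos[of "\<lambda>t. energy (line \<xi> ?v t)"
          "\<lambda>t. energy' (line \<xi> ?v t) ?v" "\<lambda>t. energy'' (line \<xi> ?v t) ?v"]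
        has_real_derivative_energy_line has_real_derivative_energy'_line energy''_line_pos line_diff_in_Omega)
  then show "energy (\<lambda>i. (1 - r) * \<xi> i + r * \<eta> i) < (1 - r) * energy \<xi> + r * energy \<eta>"
    unfolding eq line_endpoints .
qed

text \<open>On the segment from \<xi> to \<eta> the derivative of the energy vanishes at the start
  and the second derivative is positive. The strict inequality yields both minimality and
  uniqueness.\<close>

lemma energy_less_if_critical:
  assumes "\<xi> \<in> Omega m" "\<And>i. i \<in> {1..m} \<Longrightarrow> residual \<xi> i = 0" "\<eta> \<in> Omega m" "\<eta> \<noteq> \<xi>"
  shows "energy \<xi> < energy \<eta>"
proof -
  let ?v = "\<lambda>i. \<eta> i - \<xi> i"
  have "energy (line \<xi> ?v 0) < energy (line \<xi> ?v 1)"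
  proof (rule less_of_second_derivative_pos[of "\<lambda>t. energy (line \<xi> ?v t)"
        "\<lambda>t. energy' (line \<xi> ?v t) ?v" "\<lambda>t. energy'' (line \<xi> ?v t) ?v"])
    show "energy' (line \<xi> ?v 0) ?v = 0"
      by (simp add: line_endpoints energy'_eq_residual assms(2))
  qed (use assms in \<open>auto intro!: has_real_derivative_energy_line has_real_derivative_energy'_line
      energy''_line_pos line_diff_in_Omega\<close>)
  then show ?thesis unfolding line_endpoints .
qed

end

section \<open>Coercivity and the critical point\<close>

lemma continuous_on_F_at:
  assumes "c > 0"
  shows "continuous_on S (\<lambda>\<xi>. F_at m c \<xi> j)"
proof -
  have "continuous_on S (\<lambda>\<xi>::nat \<Rightarrow> real. \<xi> j)"
    by (rule continuous_on_subset[OF continuous_on_product_coordinates]) simp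
  then show ?thesis
    unfolding F_at_eq[OF assms] using assms by (cases "j = 0"; cases "j \<le> m") (auto intro!: continuous_intros)
qed

lemma continuous_on_gap: "a i > 0 \<Longrightarrow> continuous_on S (\<lambda>\<xi>. gap m a \<xi> i)"
  unfolding gap_def by (intro continuous_intros continuous_on_F_at)

text \<open>Tychonoff's theorem, carried over from \<open>product_topology\<close> to the topology
  of the function type.\<close>

lemma compact_PiE_UNIV:
  fixes B :: "'i \<Rightarrow> 'a::topological_space set"
  assumes "\<And>i. compact (B i)"
  shows "compact (PiE UNIV B)"
proof -
  have "compactin (product_topology (\<lambda>_. euclidean) UNIV) (PiE UNIV B)"
    using assms by (simp add: compactin_PiE)
  then show ?thesis by (simp add: euclidean_product_topology)
qed

text \<open>A converse of \<open>gap_pos\<close>. It allows closed conditions of the form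
  \<open>\<epsilon> \<le> gap m a \<xi> i\<close> with \<open>\<epsilon> > 0\<close> to enforce
  membership in \<open>Omega m\<close>.\<close>

lemma in_Omega_if_gap_pos:
  assumes "\<And>i. i \<notin> {1..m} \<Longrightarrow> \<xi> i = 0" "\<And>i. i \<le> m \<Longrightarrow> a i > 0" "\<And>i. i \<le> m \<Longrightarrow> gap m a \<xi> i > 0"
  shows "\<xi> \<in> Omega m"
proof (rule OmegaI)
  fix i assume "1 \<le> i" "i < m"
  then have "F (ereal (\<xi> i / a i)) < F (ereal (\<xi> (i + 1) / a i))"
    using assms(2,3)[of i] by (auto simp: gap_def F_at_eq)
  then show "\<xi> i < \<xi> (i + 1)"
    using assms(2)[of i] \<open>i < m\<close> by (simp add: F_strict_mono divide_less_cancel)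
qed (use assms in auto)

section \<open>Compactness of the sublevel sets\<close>

context stefan_data
begin

text \<open>Since gaps are at most \<open>1\<close>, every logarithmic summand of the energy is
  nonnegative, and so are the quadratic ones. Each single summand is therefore bounded by
  \<open>c\<close>.\<close>

lemma gap_ge_if_energy_le:
  assumes "\<xi> \<in> Omega m" "energy \<xi> \<le> c" "i \<le> m"
  shows "exp (- c / weight i) \<le> gap m a \<xi> i"
proof -
  have pos: "gap m a \<xi> j > 0" if "j \<le> m" for j
    using gap_pos[OF assms(1) that, of a] a[OF that] .
  have "weight j * - ln (gap m a \<xi> j) \<ge> 0" if "j \<le> m" for j
    using weight_pos[OF that] gap_le_1[OF that, of a] a[OF that] pos[OF that]
    by (intro mult_nonneg_nonneg) auto
  then have "weight i * - ln (gap m a \<xi> i) \<le> (\<Sum>j = 0..m. weight j * - ln (gap m a \<xi> j))"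
    using assms(3) by (intro member_le_sum) auto
  also have "\<dots> \<le> energy \<xi>"
  proof -
    have "(\<Sum>j = 1..m. d j * (\<xi> j)\<^sup>2 / 4) \<ge> 0" using d by (intro sum_nonneg) auto
    then show ?thesis by (simp add: energy_eq sum_negf)
  qed
  finally have "- c \<le> ln (gap m a \<xi> i) * weight i"
    using assms(2) by (simp add: mult.commute)
  then have "- c / weight i \<le> ln (gap m a \<xi> i)"
    using weight_pos[OF assms(3)] by (simp only: pos_divide_le_eq)
  then show ?thesis using pos[OF assms(3)] by (simp only: ln_ge_iff)
qed

text \<open>The compact set is a box intersected with lower bounds on the gaps. The box bounds the
  coordinates; the gap bounds keep the set away from the boundary of \<open>Omega m\<close>, where
  neighbouring coordinates coincide.\<close>

lemma sublevel_subset_compact: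
  obtains C where "compact C" "C \<subseteq> Omega m" "{\<xi> \<in> Omega m. energy \<xi> \<le> c} \<subseteq> C"
proof -
  define \<epsilon> where "\<epsilon> = Min ((\<lambda>i. exp (- c / weight i)) ` {0..m})"
  have "\<epsilon> > 0" by (auto simp: \<epsilon>_def)
  have \<epsilon>_le: "\<epsilon> \<le> gap m a \<xi> i" if "\<xi> \<in> Omega m" "energy \<xi> \<le> c" "i \<le> m" for \<xi> i
  proof -
    have "\<epsilon> \<le> exp (- c / weight i)" using that(3) by (auto simp: \<epsilon>_def intro!: Min_le)
    also have "\<dots> \<le> gap m a \<xi> i" using gap_ge_if_energy_le[OF that] .
    finally show ?thesis .
  qed
  have "\<forall>\<^sub>F x in at_bot. F (ereal x) < \<epsilon>"
    using order_tendstoD(2)[OF tendsto_F_at_bot \<open>\<epsilon> > 0\<close>] .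
  then obtain l where l: "\<And>x. x \<le> l \<Longrightarrow> F (ereal x) < \<epsilon>"
    by (auto simp: eventually_at_bot_linorder)
  have "\<forall>\<^sub>F x in at_top. F (ereal x) > 1 - \<epsilon>"
    using order_tendstoD(1)[OF tendsto_F_at_top, of "1 - \<epsilon>"] \<open>\<epsilon> > 0\<close> by simp
  then obtain r where r: "\<And>x. r \<le> x \<Longrightarrow> F (ereal x) > 1 - \<epsilon>"
    by (auto simp: eventually_at_top_linorder)
  \<comment> \<open>Phase \<open>0\<close> has gap \<open>F (ereal (\<xi> 1 / a 0))\<close> and
    phase \<open>m\<close> has gap \<open>1 - F (ereal (\<xi> m / a m))\<close>. Both are at least
    \<epsilon>, so \<open>\<xi> 1\<close> exceeds \<open>a 0 * l\<close> and \<open>\<xi> m\<close>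
    stays below \<open>a m * r\<close>; the other coordinates lie in between.\<close>
  define B where "B i = (if i \<in> {1..m} then {a 0 * l..a m * r} else {0})" for i
  define C where "C = PiE UNIV B \<inter> (\<Inter>i\<in>{0..m}. {\<xi>. \<epsilon> \<le> gap m a \<xi> i})"
  show ?thesis
  proof
    have "closed {\<xi>. \<epsilon> \<le> gap m a \<xi> i}" if "i \<le> m" for i
      using a[OF that] by (intro closed_Collect_le continuous_on_gap continuous_on_const)
    then show "compact C"
      unfolding C_def by (intro compact_Int_closed compact_PiE_UNIV closed_INT) (auto simp: B_def)
    show "C \<subseteq> Omega m"
    proof
      fix \<xi> assume \<xi>: "\<xi> \<in> C"
      then have "\<xi> i \<in> B i" for i by (auto simp: C_def PiE_def Pi_def)
      then have "\<xi> i = 0" if "i \<notin> {1..m}" for i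
        using that by (metis B_def singletonD)
      then show "\<xi> \<in> Omega m"
        using a \<xi> \<open>\<epsilon> > 0\<close> by (intro in_Omega_if_gap_pos[of m \<xi> a]) (force simp: C_def)+
    qed
    show "{\<xi> \<in> Omega m. energy \<xi> \<le> c} \<subseteq> C"
    proof
      fix \<xi> assume "\<xi> \<in> {\<xi> \<in> Omega m. energy \<xi> \<le> c}"
      then have \<xi>: "\<xi> \<in> Omega m" "energy \<xi> \<le> c" by auto
      have "\<xi> i \<in> {a 0 * l..a m * r}" if i: "i \<in> {1..m}" for i
      proof -
        have "F (ereal (\<xi> 1 / a 0)) \<ge> \<epsilon>"
          using \<epsilon>_le[OF \<xi>, of 0] i a[of 0] by (simp add: gap_def F_at_eq)
        then have "l < \<xi> 1 / a 0" using l by (meson not_le)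
        then have "a 0 * l < \<xi> 1" using a[of 0] by (simp add: pos_less_divide_eq mult.commute)
        moreover have "\<xi> 1 \<le> \<xi> i" using OmegaD[OF \<xi>(1), of 1 i] i by (cases "i = 1") auto
        moreover have "F (ereal (\<xi> m / a m)) \<le> 1 - \<epsilon>"
          using \<epsilon>_le[OF \<xi>, of m] i a[of m] by (simp add: gap_def F_at_eq)
        then have "\<xi> m / a m < r" using r by (meson not_le)
        then have "\<xi> m < a m * r" using a[of m] by (simp add: pos_divide_less_eq mult.commute)
        moreover have "\<xi> i \<le> \<xi> m" using OmegaD[OF \<xi>(1), of i m] i by (cases "i = m") auto
        ultimately show ?thesis by auto
      qed
      then show "\<xi> \<in> C"
        using Omega_vanish[OF \<xi>(1)] \<epsilon>_le[OF \<xi>] by (auto simp: C_def B_def)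
    qed
  qed
qed

lemma continuous_on_energy: "S \<subseteq> Omega m \<Longrightarrow> continuous_on S energy"
proof -
  assume S: "S \<subseteq> Omega m"
  have "continuous_on S (\<lambda>\<xi>::nat \<Rightarrow> real. \<xi> j)" for j
    by (rule continuous_on_subset[OF continuous_on_product_coordinates]) simp
  moreover have "continuous_on S (\<lambda>\<xi>. ln (gap m a \<xi> i))" if "i \<le> m" for i
    using a[OF that] S that gap_pos[of _ m i a]
    by (intro continuous_on_ln continuous_on_gap) force+
  ultimately show ?thesis
    unfolding energy_eq
    by (intro continuous_on_add continuous_on_minus continuous_on_sum continuous_on_mult
        continuous_on_divide continuous_on_power continuous_on_const) auto
qed

lemma compact_sublevel: "compact {\<xi> \<in> Omega m. energy \<xi> \<le> c}"
proof -
  obtain C where C: "compact C" "C \<subseteq> Omega m" "{\<xi> \<in> Omega m. energy \<xi> \<le> c} \<subseteq> C"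
    using sublevel_subset_compact .
  have "closedin (top_of_set C) (C \<inter> energy -` {..c})"
    by (intro continuous_closedin_preimage continuous_on_energy C closed_atMost)
  then have "compact (C \<inter> energy -` {..c})"
    using C(1) closedin_compact by blast
  moreover have "C \<inter> energy -` {..c} = {\<xi> \<in> Omega m. energy \<xi> \<le> c}" using C by auto
  ultimately show ?thesis by simp
qed

section \<open>Existence and uniqueness of the critical point\<close>

lemma energy_attains_min:
  obtains \<xi> where "\<xi> \<in> Omega m" "\<And>\<eta>. \<eta> \<in> Omega m \<Longrightarrow> energy \<xi> \<le> energy \<eta>"
proof -
  \<comment> \<open>Any point of \<open>Omega m\<close> would serve; its sublevel set is nonempty
    and compact, and a minimum there is a global one.\<close>
  define \<zeta> :: "nat \<Rightarrow> real" where "\<zeta> i = (if i \<in> {1..m} then real i else 0)" for i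
  have \<zeta>: "\<zeta> \<in> Omega m" by (rule OmegaI) (auto simp: \<zeta>_def)
  let ?K = "{\<xi> \<in> Omega m. energy \<xi> \<le> energy \<zeta>}"
  obtain \<xi> where \<xi>: "\<xi> \<in> ?K" "\<forall>\<eta>\<in>?K. energy \<xi> \<le> energy \<eta>"
    using continuous_attains_inf[OF compact_sublevel _ continuous_on_energy, of "energy \<zeta>"] \<zeta> by blast
  show ?thesis
  proof (rule that)
    fix \<eta> assume "\<eta> \<in> Omega m"
    then show "energy \<xi> \<le> energy \<eta>"
      using \<xi> by (cases "energy \<eta> \<le> energy \<zeta>") auto
  qed (use \<xi> in auto)
qed

lemma residual_eq_0_if_min:
  assumes \<xi>: "\<xi> \<in> Omega m" and min: "\<And>\<eta>. \<eta> \<in> Omega m \<Longrightarrow> energy \<xi> \<le> energy \<eta>" and i: "i \<in> {1..m}"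
  shows "residual \<xi> i = 0"
proof -
  \<comment> \<open>The \<open>i\<close>-th unit vector. The finitely many strict inequalities
    between neighbours persist for small \<open>t\<close>, so \<open>line \<xi> v t\<close> remains
    in \<open>Omega m\<close> and \<open>t = 0\<close> is a local minimum.\<close>
  define v :: "nat \<Rightarrow> real" where "v = (\<lambda>j. if j = i then 1 else 0)"
  have "\<forall>\<^sub>F t in nhds 0. line \<xi> v t j < line \<xi> v t (j + 1)" if "j \<in> {1..<m}" for j
  proof -
    have "((\<lambda>t. line \<xi> v t (j + 1) - line \<xi> v t j) \<longlongrightarrow> \<xi> (j + 1) - \<xi> j) (nhds 0)"
      unfolding line_def by (rule tendsto_eq_intros filterlim_ident refl | simp)+
    moreover have "0 < \<xi> (j + 1) - \<xi> j" using OmegaD[OF \<xi>, of j "j + 1"] that by auto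
    ultimately have "\<forall>\<^sub>F t in nhds 0. 0 < line \<xi> v t (j + 1) - line \<xi> v t j"
      by (rule order_tendstoD(1))
    then show ?thesis by simp
  qed
  then have "\<forall>\<^sub>F t in nhds 0. \<forall>j\<in>{1..<m}. line \<xi> v t j < line \<xi> v t (j + 1)"
    by (intro eventually_ball_finite) auto
  then obtain \<delta> where \<delta>: "\<delta> > 0" "\<And>t j. \<bar>t\<bar> < \<delta> \<Longrightarrow> j \<in> {1..<m} \<Longrightarrow> line \<xi> v t j < line \<xi> v t (j + 1)"
    unfolding eventually_nhds_metric by (auto simp: dist_real_def)
  have "line \<xi> v t \<in> Omega m" if "\<bar>t\<bar> < \<delta>" for t
    using \<delta>(2)[OF that] i Omega_vanish[OF \<xi>] by (intro OmegaI) (auto simp: line_def v_def)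
  then have "energy' (line \<xi> v 0) v = 0"
    using \<xi> min by (intro DERIV_local_min[OF has_real_derivative_energy_line \<delta>(1)]) (auto simp: line_endpoints)
  then have "(\<Sum>j = 1..m. residual \<xi> j * v j) = 0"
    by (simp add: line_endpoints energy'_eq_residual)
  also have "(\<Sum>j = 1..m. residual \<xi> j * v j) = residual \<xi> i"
    using i by (simp add: v_def mult_delta_right)
  finally show ?thesis .
qed

text \<open>A minimum point is critical. Two distinct critical points would each have strictly
  smaller energy than the other.\<close>

lemma ex1_critical: "\<exists>!\<xi>. \<xi> \<in> Omega m \<and> (\<forall>i\<in>{1..m}. residual \<xi> i = 0)"
proof -
  obtain \<xi> where "\<xi> \<in> Omega m" "\<And>\<eta>. \<eta> \<in> Omega m \<Longrightarrow> energy \<xi> \<le> energy \<eta>"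
    using energy_attains_min by blast
  then have \<xi>: "\<xi> \<in> Omega m" "\<forall>i\<in>{1..m}. residual \<xi> i = 0"
    using residual_eq_0_if_min by blast+
  moreover have "\<eta> = \<xi>" if "\<eta> \<in> Omega m" "\<forall>i\<in>{1..m}. residual \<eta> i = 0" for \<eta>
    using energy_less_if_critical[of \<xi> \<eta>] energy_less_if_critical[of \<eta> \<xi>] \<xi> that
    by fastforce
  ultimately show ?thesis by blast
qed

lemma is_arg_min_iff_if_critical:
  assumes "\<xi> \<in> Omega m" "\<forall>i\<in>{1..m}. residual \<xi> i = 0"
  shows "is_arg_min energy (\<lambda>\<zeta>. \<zeta> \<in> Omega m) \<eta> \<longleftrightarrow> \<eta> = \<xi>"
  using energy_less_if_critical[OF assms(1)] assms unfolding is_arg_min_def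
  by (metis less_asym)

end

section \<open>Self-similar solutions\<close>

definition phase :: "nat \<Rightarrow> (nat \<Rightarrow> real) \<Rightarrow> nat \<Rightarrow> real set" where
  "phase m \<xi> i = {y. bdry m \<xi> i < ereal y \<and> ereal y < bdry m \<xi> (i + 1)}"

lemma open_phase: "open (phase m \<xi> i)"
  unfolding phase_def
  by (intro open_Collect_conj open_Collect_less continuous_on_const continuous_on_ereal continuous_on_id)

lemma bdry_less: "\<xi> \<in> Omega m \<Longrightarrow> i < j \<Longrightarrow> j \<le> m + 1 \<Longrightarrow> bdry m \<xi> i < bdry m \<xi> j"
  using OmegaD[of \<xi> m i j] by (auto simp: bdry_def)

lemma F_at_less:
  "c > 0 \<Longrightarrow> bdry m \<xi> i < ereal y \<Longrightarrow> F_at m c \<xi> i < F (ereal (y / c))"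
  "c > 0 \<Longrightarrow> ereal y < bdry m \<xi> i \<Longrightarrow> F (ereal (y / c)) < F_at m c \<xi> i"
  using F_bounds by (auto simp: F_at_eq bdry_def F_strict_mono divide_strict_right_mono split: if_splits)

lemma F_at_if_bdry_eq: "c > 0 \<Longrightarrow> bdry m \<xi> i = ereal y \<Longrightarrow> F_at m c \<xi> i = F (ereal (y / c))"
  by (auto simp: F_at_eq bdry_def split: if_splits)

context stefan_data
begin

definition slope :: "(nat \<Rightarrow> real) \<Rightarrow> nat \<Rightarrow> real" where
  "slope \<xi> i = (u (i + 1) - u i) / gap m a \<xi> i"

text \<open>The formula of \<open>profile\<close> on phase \<open>i\<close>, taken for every real
  \<open>y\<close>. It is differentiable across the interfaces too, which the one-sided limits of
  \<open>u_x\<close> rely on.\<close>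

definition piece :: "(nat \<Rightarrow> real) \<Rightarrow> nat \<Rightarrow> real \<Rightarrow> real" where
  "piece \<xi> i y = u i + slope \<xi> i * (F (ereal (y / a i)) - F_at m (a i) \<xi> i)"

definition piece' :: "(nat \<Rightarrow> real) \<Rightarrow> nat \<Rightarrow> real \<Rightarrow> real" where
  "piece' \<xi> i y = slope \<xi> i * gauss (y / a i) / a i"

definition temperature :: "(nat \<Rightarrow> real) \<Rightarrow> real \<Rightarrow> real \<Rightarrow> real" where
  "temperature \<xi> t x = profile m u a \<xi> (x / sqrt t)"

lemma u_less: "i < j \<Longrightarrow> j \<le> m + 1 \<Longrightarrow> u i < u j"
proof (induction j)
  case (Suc j)
  then show ?case using u[of j] by (cases "i = j") auto
qed simp

lemma has_real_derivative_piece [derivative_intros]: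
  assumes "i \<le> m" "(f has_real_derivative f') (at x within S)"
  shows "((\<lambda>x. piece \<xi> i (f x)) has_real_derivative piece' \<xi> i (f x) * f') (at x within S)"
  using a[OF assms(1)] unfolding piece_def piece'_def
  by (auto intro!: derivative_eq_intros assms(2))

text \<open>For \<open>f\<close> the identity this is the heat equation in self-similar form,
  \<open>a^2 * v'' = - y / 2 * v'\<close>.\<close>

lemma has_real_derivative_piece' [derivative_intros]:
  assumes "i \<le> m" "(f has_real_derivative f') (at x within S)"
  shows "((\<lambda>x. piece' \<xi> i (f x)) has_real_derivative
    - f x / (2 * (a i)\<^sup>2) * piece' \<xi> i (f x) * f') (at x within S)"
  using a[OF assms(1)] unfolding piece'_def
  by (auto intro!: derivative_eq_intros assms(2) simp: power2_eq_square field_simps)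

context
  fixes \<xi> :: "nat \<Rightarrow> real"
  assumes \<xi>: "\<xi> \<in> Omega m"
begin

section \<open>Monotone shape of the profile\<close>

lemma slope_pos: "i \<le> m \<Longrightarrow> slope \<xi> i > 0"
  using u[of i] gap_pos[OF \<xi>, of i a] a[of i] by (simp add: slope_def)

lemma profile_eq_piece:
  assumes "i \<le> m" "bdry m \<xi> i \<le> ereal y" "ereal y < bdry m \<xi> (i + 1)"
  shows "profile m u a \<xi> y = piece \<xi> i y"
proof -
  have "j \<le> i" if "j \<le> m" "bdry m \<xi> j \<le> ereal y" for j
  proof (rule ccontr)
    assume "\<not> j \<le> i"
    then have "bdry m \<xi> (i + 1) \<le> bdry m \<xi> j"
      using bdry_less[OF \<xi>, of "i + 1" j] that by (cases "j = i + 1") auto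
    then show False using assms that by simp
  qed
  then have "Max {i \<in> {0..m}. bdry m \<xi> i \<le> ereal y} = i"
    using assms by (intro Max_eqI) auto
  then show ?thesis
    using a[OF assms(1)] by (simp add: profile_def Let_def piece_def slope_def gap_def F_at_def)
qed

lemma phase_cases:
  obtains i where "i \<le> m" "bdry m \<xi> i \<le> ereal y" "ereal y < bdry m \<xi> (i + 1)"
proof -
  let ?A = "{i \<in> {0..m}. bdry m \<xi> i \<le> ereal y}"
  define i where "i = Max ?A"
  have "0 \<in> ?A" by (simp add: bdry_def)
  then have i: "i \<in> ?A" unfolding i_def by (intro Max_in) auto
  moreover have "ereal y < bdry m \<xi> (i + 1)"
  proof (rule ccontr)
    assume *: "\<not> ereal y < bdry m \<xi> (i + 1)"
    then have "i + 1 \<le> m" by (auto simp: bdry_def split: if_splits)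
    then have "i + 1 \<in> ?A" using * by simp
    then have "i + 1 \<le> i" unfolding i_def by (intro Max_ge) auto
    then show False by simp
  qed
  ultimately show ?thesis using that[of i] by simp
qed

lemma piece_bounds:
  assumes "i \<le> m" "bdry m \<xi> i \<le> ereal y" "ereal y < bdry m \<xi> (i + 1)"
  shows "u i \<le> piece \<xi> i y" "piece \<xi> i y < u (i + 1)" "piece \<xi> i y = u i \<longleftrightarrow> bdry m \<xi> i = ereal y"
proof -
  note pos = slope_pos[OF assms(1)] a[OF assms(1)]
  have *: "F (ereal (y / a i)) \<ge> F_at m (a i) \<xi> i"
    "F (ereal (y / a i)) = F_at m (a i) \<xi> i \<longleftrightarrow> bdry m \<xi> i = ereal y"
    using assms(2) F_at_less(1)[OF pos(2), of m \<xi> i y] F_at_if_bdry_eq[OF pos(2), of m \<xi> i y]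
    by (auto simp: le_less)
  show "u i \<le> piece \<xi> i y" "piece \<xi> i y = u i \<longleftrightarrow> bdry m \<xi> i = ereal y"
    using * pos by (auto simp: piece_def)
  have "slope \<xi> i * (F (ereal (y / a i)) - F_at m (a i) \<xi> i) < slope \<xi> i * gap m a \<xi> i"
    using pos F_at_less(2)[OF pos(2) assms(3)] by (simp add: gap_def)
  also have "\<dots> = u (i + 1) - u i"
    using gap_pos[OF \<xi> assms(1), of a] pos by (simp add: slope_def)
  finally show "piece \<xi> i y < u (i + 1)" by (simp add: piece_def)
qed

text \<open>If \<open>y\<close> lies in phase \<open>j\<close>, its value is in the half-open
  interval from \<open>u j\<close> to \<open>u (j + 1)\<close>; comparing \<open>j\<close> with
  \<open>i\<close> orders both the values and the points.\<close>

lemma profile_level: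
  assumes "i \<in> {1..m}"
  shows "profile m u a \<xi> y < u i \<longleftrightarrow> y < \<xi> i" "profile m u a \<xi> y = u i \<longleftrightarrow> y = \<xi> i"
    "u i < profile m u a \<xi> y \<longleftrightarrow> \<xi> i < y"
proof -
  have bdry_i: "bdry m \<xi> i = ereal (\<xi> i)" using assms by (simp add: bdry_def)
  obtain j where j: "j \<le> m" "bdry m \<xi> j \<le> ereal y" "ereal y < bdry m \<xi> (j + 1)"
    using phase_cases .
  note p = profile_eq_piece[OF j] piece_bounds[OF j]
  have less: "profile m u a \<xi> y < u i" if "y < \<xi> i"
  proof -
    have "j < i"
    proof (rule ccontr)
      assume "\<not> j < i"
      then have "bdry m \<xi> i \<le> bdry m \<xi> j" using bdry_less[OF \<xi>, of i j] j by (cases "i = j") auto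
      also note j(2)
      finally show False using that by (simp add: bdry_i)
    qed
    then have "u (j + 1) \<le> u i" using u_less[of "j + 1" i] assms by (cases "j + 1 = i") auto
    then show ?thesis using p by simp
  qed
  have greater: "u i < profile m u a \<xi> y" if "\<xi> i < y"
  proof -
    have "i \<le> j"
    proof (rule ccontr)
      assume "\<not> i \<le> j"
      then have "bdry m \<xi> (j + 1) \<le> bdry m \<xi> i"
        using bdry_less[OF \<xi>, of "j + 1" i] assms by (cases "i = j + 1") auto
      with j(3) have "ereal y < bdry m \<xi> i" by simp
      then show False using that by (simp add: bdry_i)
    qed
    show ?thesis
    proof (cases "i = j")
      case True
      then show ?thesis using p that bdry_i by auto
    next
      case False
      then have "u i < u j" using u_less[of i j] \<open>i \<le> j\<close> j by simp
      then show ?thesis using p by simp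
    qed
  qed
  have eq: "profile m u a \<xi> y = u i" if "y = \<xi> i"
    using profile_eq_piece[of i y] piece_bounds[of i y] bdry_less[OF \<xi>, of i "i + 1"] that assms bdry_i
    by auto
  show "profile m u a \<xi> y < u i \<longleftrightarrow> y < \<xi> i" "profile m u a \<xi> y = u i \<longleftrightarrow> y = \<xi> i"
    "u i < profile m u a \<xi> y \<longleftrightarrow> \<xi> i < y"
    using less greater eq by (metis less_asym less_irrefl linorder_cases)+
qed

text \<open>Translates phases given by temperature, as in \<open>heat_equation\<close>, into
  intervals of the similarity variable. For \<open>i = 0\<close> and \<open>i = m\<close> the
  infinite end imposes no condition.\<close>

lemma in_phase_if_between:
  assumes "i \<le> m" "u i < profile m u a \<xi> y" "profile m u a \<xi> y < u (i + 1)"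
  shows "y \<in> phase m \<xi> i"
  using assms profile_level(3)[of i y] profile_level(1)[of "i + 1" y]
  by (auto simp: phase_def bdry_def)

section \<open>The heat equation inside the phases\<close>

lemma temperature_eq_piece: "i \<le> m \<Longrightarrow> x / sqrt t \<in> phase m \<xi> i \<Longrightarrow> temperature \<xi> t x = piece \<xi> i (x / sqrt t)"
  unfolding temperature_def by (rule profile_eq_piece) (auto simp: phase_def)

lemma eventually_in_phase:
  assumes "x / sqrt t \<in> phase m \<xi> i" "t > 0"
  shows "\<forall>\<^sub>F x in nhds x. x / sqrt t \<in> phase m \<xi> i" "\<forall>\<^sub>F t in nhds t. x / sqrt t \<in> phase m \<xi> i"
proof -
  have "((\<lambda>x. x / sqrt t) \<longlongrightarrow> x / sqrt t) (nhds x)" "((\<lambda>t. x / sqrt t) \<longlongrightarrow> x / sqrt t) (nhds t)"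
    using assms(2) by (auto intro!: tendsto_intros filterlim_ident)
  then show "\<forall>\<^sub>F x in nhds x. x / sqrt t \<in> phase m \<xi> i" "\<forall>\<^sub>F t in nhds t. x / sqrt t \<in> phase m \<xi> i"
    using topological_tendstoD[OF _ open_phase assms(1)] by auto
qed

lemma has_real_derivative_temperature:
  assumes "i \<le> m" "t > 0" "x / sqrt t \<in> phase m \<xi> i"
  shows "(temperature \<xi> t has_real_derivative piece' \<xi> i (x / sqrt t) / sqrt t) (at x)"
proof -
  have ev: "\<forall>\<^sub>F x in nhds x. piece \<xi> i (x / sqrt t) = temperature \<xi> t x"
    using eventually_in_phase(1)[OF assms(3,2)] temperature_eq_piece[OF assms(1)]
    by (auto elim: eventually_mono)
  have deriv: "((\<lambda>x. piece \<xi> i (x / sqrt t)) has_real_derivative piece' \<xi> i (x / sqrt t) / sqrt t) (at x)"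
    using has_real_derivative_piece[OF assms(1) DERIV_cdivide[OF DERIV_ident, of "sqrt t"], of \<xi> x UNIV] by simp
  show ?thesis by (rule DERIV_cong_ev[OF refl ev refl, THEN iffD1, OF deriv])
qed

lemma deriv_temperature:
  "i \<le> m \<Longrightarrow> t > 0 \<Longrightarrow> x / sqrt t \<in> phase m \<xi> i \<Longrightarrow>
    deriv (temperature \<xi> t) x = piece' \<xi> i (x / sqrt t) / sqrt t"
  by (rule DERIV_imp_deriv[OF has_real_derivative_temperature])

lemma has_real_derivative_deriv_temperature:
  assumes "i \<le> m" "t > 0" "x / sqrt t \<in> phase m \<xi> i"
  shows "(deriv (temperature \<xi> t) has_real_derivative
    - (x / sqrt t) / (2 * (a i)\<^sup>2) * piece' \<xi> i (x / sqrt t) / t) (at x)"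
proof -
  have ev: "\<forall>\<^sub>F x in nhds x. piece' \<xi> i (x / sqrt t) / sqrt t = deriv (temperature \<xi> t) x"
    using eventually_in_phase(1)[OF assms(3,2)] deriv_temperature[OF assms(1,2)]
    by (auto elim: eventually_mono)
  have deriv: "((\<lambda>x. piece' \<xi> i (x / sqrt t) / sqrt t) has_real_derivative
      - (x / sqrt t) / (2 * (a i)\<^sup>2) * piece' \<xi> i (x / sqrt t) * (1 / sqrt t) / sqrt t) (at x)"
    by (intro DERIV_cdivide derivative_intros assms(1) DERIV_ident)
  have eq: "- (x / sqrt t) / (2 * (a i)\<^sup>2) * piece' \<xi> i (x / sqrt t) * (1 / sqrt t) / sqrt t =
      - (x / sqrt t) / (2 * (a i)\<^sup>2) * piece' \<xi> i (x / sqrt t) / t"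
    using assms(2) by simp
  show ?thesis by (rule DERIV_cong_ev[OF refl ev eq, THEN iffD1, OF deriv])
qed

lemma has_real_derivative_temperature_time:
  assumes "i \<le> m" "t > 0" "x / sqrt t \<in> phase m \<xi> i"
  shows "((\<lambda>s. temperature \<xi> s x) has_real_derivative
    - (x / sqrt t) / 2 * piece' \<xi> i (x / sqrt t) / t) (at t)"
proof -
  have ev: "\<forall>\<^sub>F s in nhds t. piece \<xi> i (x / sqrt s) = temperature \<xi> s x"
    using eventually_in_phase(2)[OF assms(3,2)] temperature_eq_piece[OF assms(1)]
    by (auto elim: eventually_mono)
  have "((\<lambda>s. x / sqrt s) has_real_derivative - (x / sqrt t) / 2 / t) (at t)"
    using assms(2) by (auto intro!: derivative_eq_intros simp: field_simps)
  then have deriv: "((\<lambda>s. piece \<xi> i (x / sqrt s)) has_real_derivative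
      piece' \<xi> i (x / sqrt t) * (- (x / sqrt t) / 2 / t)) (at t)"
    using assms(1) by (intro derivative_intros)
  have eq: "piece' \<xi> i (x / sqrt t) * (- (x / sqrt t) / 2 / t) =
      - (x / sqrt t) / 2 * piece' \<xi> i (x / sqrt t) / t" by simp
  show ?thesis by (rule DERIV_cong_ev[OF refl ev eq, THEN iffD1, OF deriv])
qed

text \<open>With \<open>y = x / sqrt t\<close>, both the time derivative and \<open>(a i)^2\<close>
  times the second space derivative equal \<open>- y / 2 * piece' \<xi> i y / t\<close>.\<close>

lemma heat_equation_temperature: "heat_equation m u a (temperature \<xi>)"
  unfolding heat_equation_def
proof (intro ballI allI impI; elim conjE)
  fix i and t x :: real
  assume "i \<in> {0..m}" and t: "t > 0" and "u i < temperature \<xi> t x" "temperature \<xi> t x < u (i + 1)"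
  then have i: "i \<le> m" and x: "x / sqrt t \<in> phase m \<xi> i"
    using in_phase_if_between by (auto simp: temperature_def)
  have "\<forall>\<^sub>F y in nhds x. temperature \<xi> t differentiable at y"
    using eventually_in_phase(1)[OF x t] has_real_derivative_temperature[OF i t]
    by (auto elim!: eventually_mono simp: real_differentiable_def)
  moreover note has_real_derivative_deriv_temperature[OF i t x]
  moreover have "(a i)\<^sup>2 * (- (x / sqrt t) / (2 * (a i)\<^sup>2) * piece' \<xi> i (x / sqrt t) / t) =
      - (x / sqrt t) / 2 * piece' \<xi> i (x / sqrt t) / t"
    using a[OF i] by simp
  ultimately show "(\<forall>\<^sub>F y in nhds x. temperature \<xi> t differentiable at y) \<and>
      deriv (temperature \<xi> t) differentiable at x \<and>
      ((\<lambda>s. temperature \<xi> s x) has_real_derivative (a i)\<^sup>2 * deriv (deriv (temperature \<xi> t)) x) (at t)"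
    using has_real_derivative_temperature_time[OF i t x]
    by (metis DERIV_imp_deriv real_differentiable_def)
qed

section \<open>The Stefan condition at the interfaces\<close>

lemma temperature_level:
  assumes "i \<in> {1..m}" "t > 0"
  shows "{x. temperature \<xi> t x < u i} = {..<\<xi> i * sqrt t}"
    "{x. temperature \<xi> t x = u i} = {\<xi> i * sqrt t}"
    "{x. u i < temperature \<xi> t x} = {\<xi> i * sqrt t<..}"
  using assms by (auto simp: temperature_def profile_level field_simps)

text \<open>Near the interface, but not at it, the derivative is given by \<open>piece'\<close>, and
  \<open>piece'\<close> is continuous at the interface as well.\<close>

lemma tendsto_deriv_temperature:
  assumes "i \<le> m" "t > 0" "\<forall>\<^sub>F x in at (y * sqrt t) within S. x / sqrt t \<in> phase m \<xi> i"
  shows "(deriv (temperature \<xi> t) \<longlongrightarrow> piece' \<xi> i y / sqrt t) (at (y * sqrt t) within S)"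
proof (rule Lim_transform_eventually)
  have "((\<lambda>x. piece' \<xi> i (x / sqrt t)) has_real_derivative
      - (y * sqrt t / sqrt t) / (2 * (a i)\<^sup>2) * piece' \<xi> i (y * sqrt t / sqrt t) * (1 / sqrt t))
      (at (y * sqrt t) within S)"
    by (intro derivative_intros assms(1) DERIV_cdivide DERIV_ident)
  then have "((\<lambda>x. piece' \<xi> i (x / sqrt t)) \<longlongrightarrow> piece' \<xi> i y) (at (y * sqrt t) within S)"
    using DERIV_continuous assms(2) by (fastforce simp: continuous_within)
  then show "((\<lambda>x. piece' \<xi> i (x / sqrt t) / sqrt t) \<longlongrightarrow> piece' \<xi> i y / sqrt t) (at (y * sqrt t) within S)"
    using assms(2) by (intro tendsto_intros) auto
  show "\<forall>\<^sub>F x in at (y * sqrt t) within S. piece' \<xi> i (x / sqrt t) / sqrt t = deriv (temperature \<xi> t) x"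
    using assms(3) by eventually_elim (simp add: deriv_temperature[OF assms(1,2)])
qed

lemma eventually_in_phase_right:
  assumes "i \<in> {1..m}" "t > 0"
  shows "\<forall>\<^sub>F x in at_right (\<xi> i * sqrt t). x / sqrt t \<in> phase m \<xi> i"
proof -
  have "((\<lambda>x. ereal (x / sqrt t)) \<longlongrightarrow> ereal (\<xi> i)) (at_right (\<xi> i * sqrt t))"
    using assms(2) by (auto intro!: tendsto_eq_intros)
  moreover have "ereal (\<xi> i) < bdry m \<xi> (i + 1)"
    using bdry_less[OF \<xi>, of i "i + 1"] assms(1) by (simp add: bdry_def)
  ultimately have "\<forall>\<^sub>F x in at_right (\<xi> i * sqrt t). ereal (x / sqrt t) < bdry m \<xi> (i + 1)"
    by (rule order_tendstoD)
  moreover have "\<forall>\<^sub>F x in at_right (\<xi> i * sqrt t). \<xi> i * sqrt t < x"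
    by (rule eventually_at_right_less)
  ultimately show ?thesis
    by eventually_elim (use assms in \<open>simp add: phase_def bdry_def field_simps\<close>)
qed

lemma eventually_in_phase_left:
  assumes "i \<in> {1..m}" "t > 0"
  shows "\<forall>\<^sub>F x in at_left (\<xi> i * sqrt t). x / sqrt t \<in> phase m \<xi> (i - 1)"
proof -
  have "((\<lambda>x. ereal (x / sqrt t)) \<longlongrightarrow> ereal (\<xi> i)) (at_left (\<xi> i * sqrt t))"
    using assms(2) by (auto intro!: tendsto_eq_intros)
  moreover have "bdry m \<xi> (i - 1) < ereal (\<xi> i)"
    using bdry_less[OF \<xi>, of "i - 1" i] assms(1) by (simp add: bdry_def)
  ultimately have "\<forall>\<^sub>F x in at_left (\<xi> i * sqrt t). bdry m \<xi> (i - 1) < ereal (x / sqrt t)"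
    by (rule order_tendstoD)
  moreover have "\<forall>\<^sub>F x in at_left (\<xi> i * sqrt t). x \<in> {..<\<xi> i * sqrt t}"
    by (simp add: eventually_at_filter)
  ultimately show ?thesis
    by eventually_elim (use assms in \<open>simp add: phase_def bdry_def field_simps\<close>)
qed

text \<open>The residual is the left-hand side of the Stefan condition at time
  \<open>1\<close>.\<close>

lemma residual_eq_piece':
  "residual \<xi> i = d i * \<xi> i / 2 + k i * piece' \<xi> i (\<xi> i) - k (i - 1) * piece' \<xi> (i - 1) (\<xi> i)"
  by (cases i) (simp_all add: residual_def piece'_def slope_def weight_def)

text \<open>The interface speed and both one-sided limits scale like \<open>1 / sqrt t\<close>, so
  the condition at time \<open>t\<close> reads \<open>residual \<xi> i / sqrt t = 0\<close>.\<close>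

lemma stefan_condition_temperature_iff:
  "stefan_condition m u k d (temperature \<xi>) (\<lambda>i t. \<xi> i * sqrt t) \<longleftrightarrow> (\<forall>i\<in>{1..m}. residual \<xi> i = 0)"
proof -
  define P where "P i t \<longleftrightarrow>
      at (\<xi> i * sqrt t) within {x. temperature \<xi> t x > u i} \<noteq> bot \<and>
      at (\<xi> i * sqrt t) within {x. temperature \<xi> t x < u i} \<noteq> bot \<and>
      (\<exists>x' p q. ((\<lambda>t. \<xi> i * sqrt t) has_real_derivative x') (at t) \<and>
        (deriv (temperature \<xi> t) \<longlongrightarrow> p) (at (\<xi> i * sqrt t) within {x. temperature \<xi> t x > u i}) \<and>
        (deriv (temperature \<xi> t) \<longlongrightarrow> q) (at (\<xi> i * sqrt t) within {x. temperature \<xi> t x < u i}) \<and>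
        d i * x' + k i * p - k (i - 1) * q = 0)" for i t
  have P: "P i t \<longleftrightarrow> residual \<xi> i = 0"
    if i: "i \<in> {1..m}" and t: "t > 0" for i t
  proof -
    have x': "((\<lambda>t. \<xi> i * sqrt t) has_real_derivative \<xi> i / 2 / sqrt t) (at t)"
      using t by (auto intro!: derivative_eq_intros simp: field_simps)
    have p: "(deriv (temperature \<xi> t) \<longlongrightarrow> piece' \<xi> i (\<xi> i) / sqrt t) (at_right (\<xi> i * sqrt t))"
      using i t by (intro tendsto_deriv_temperature eventually_in_phase_right) auto
    have q: "(deriv (temperature \<xi> t) \<longlongrightarrow> piece' \<xi> (i - 1) (\<xi> i) / sqrt t) (at_left (\<xi> i * sqrt t))"
      using i t by (intro tendsto_deriv_temperature eventually_in_phase_left) auto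
    \<comment> \<open>The one-sided filters are nontrivial, so \<open>x'\<close>, \<open>p\<close>
      and \<open>q\<close> are uniquely determined and the existential collapses to an
      equation.\<close>
    have "(\<exists>x' p q. ((\<lambda>t. \<xi> i * sqrt t) has_real_derivative x') (at t) \<and>
        (deriv (temperature \<xi> t) \<longlongrightarrow> p) (at_right (\<xi> i * sqrt t)) \<and>
        (deriv (temperature \<xi> t) \<longlongrightarrow> q) (at_left (\<xi> i * sqrt t)) \<and>
        d i * x' + k i * p - k (i - 1) * q = 0) \<longleftrightarrow>
      d i * (\<xi> i / 2 / sqrt t) + k i * (piece' \<xi> i (\<xi> i) / sqrt t) -
        k (i - 1) * (piece' \<xi> (i - 1) (\<xi> i) / sqrt t) = 0"
      using x' p q DERIV_unique[OF _ x'] tendsto_unique[OF trivial_limit_at_right_real _ p]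
        tendsto_unique[OF trivial_limit_at_left_real _ q] by metis
    also have "d i * (\<xi> i / 2 / sqrt t) + k i * (piece' \<xi> i (\<xi> i) / sqrt t) -
        k (i - 1) * (piece' \<xi> (i - 1) (\<xi> i) / sqrt t) = residual \<xi> i / sqrt t"
      by (simp add: residual_eq_piece' add_divide_distrib diff_divide_distrib)
    finally show ?thesis
      using t by (simp add: P_def temperature_level[OF i t])
  qed
  have "stefan_condition m u k d (temperature \<xi>) (\<lambda>i t. \<xi> i * sqrt t) \<longleftrightarrow> (\<forall>i\<in>{1..m}. \<forall>t>0. P i t)"
    unfolding stefan_condition_def Let_def P_def ..
  \<comment> \<open>The time \<open>t = 1\<close> serves as the instance from which the residual
    equation is recovered.\<close>
  then show ?thesis using P zero_less_one[where 'a = real] by blast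
qed

section \<open>The initial data\<close>

lemma riemann_data_temperature: "riemann_data (u 0) (u (m + 1)) (temperature \<xi>)"
proof -
  have inv: "filterlim (\<lambda>t. inverse (sqrt t)) at_top (at_right 0)"
  proof (rule filterlim_compose[OF filterlim_inverse_at_top_right])
    show "filterlim sqrt (at_right 0) (at_right 0)"
      unfolding filterlim_at
      by (auto intro!: tendsto_eq_intros simp: eventually_at_filter)
  qed
  \<comment> \<open>For small \<open>t\<close> the point \<open>x / sqrt t\<close> lies in phase
    \<open>0\<close> and tends to minus infinity, so the limit is that of
    \<open>piece \<xi> 0\<close>. Phase \<open>m\<close> is treated likewise for
    \<open>x > 0\<close>.\<close>
  have "((\<lambda>t. temperature \<xi> t x) \<longlongrightarrow> u 0) (at_right 0)" if "x < 0" for x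
  proof (rule Lim_transform_eventually)
    have lim: "filterlim (\<lambda>t. x / sqrt t) at_bot (at_right 0)"
      unfolding divide_inverse using inv that
      by (intro filterlim_tendsto_neg_mult_at_bot[OF tendsto_const]) auto
    have "filterlim (\<lambda>t. 1 / a 0 * (x / sqrt t)) at_bot (at_right 0)"
      using a[of 0] by (intro filterlim_tendsto_pos_mult_at_bot[OF tendsto_const _ lim]) auto
    then have "((\<lambda>t. F (ereal (x / sqrt t / a 0))) \<longlongrightarrow> 0) (at_right 0)"
      using filterlim_compose[OF tendsto_F_at_bot] by (simp add: mult.commute)
    then show "((\<lambda>t. piece \<xi> 0 (x / sqrt t)) \<longlongrightarrow> u 0) (at_right 0)"
      unfolding piece_def using a[of 0] by (auto intro!: tendsto_eq_intros simp: F_at_eq)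
    have "\<forall>\<^sub>F t in at_right 0. x / sqrt t < \<xi> 1"
      using lim unfolding filterlim_at_bot_dense by blast
    then show "\<forall>\<^sub>F t in at_right 0. piece \<xi> 0 (x / sqrt t) = temperature \<xi> t x"
      by eventually_elim (auto simp: phase_def bdry_def intro!: temperature_eq_piece[of 0, symmetric])
  qed
  moreover have "((\<lambda>t. temperature \<xi> t x) \<longlongrightarrow> u (m + 1)) (at_right 0)" if "x > 0" for x
  proof (rule Lim_transform_eventually)
    have lim: "filterlim (\<lambda>t. x / sqrt t) at_top (at_right 0)"
      unfolding divide_inverse using inv that
      by (intro filterlim_tendsto_pos_mult_at_top[OF tendsto_const]) auto
    have "filterlim (\<lambda>t. 1 / a m * (x / sqrt t)) at_top (at_right 0)"
      using a[of m] by (intro filterlim_tendsto_pos_mult_at_top[OF tendsto_const _ lim]) auto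
    then have F: "((\<lambda>t. F (ereal (x / sqrt t / a m))) \<longlongrightarrow> 1) (at_right 0)"
      using filterlim_compose[OF tendsto_F_at_top] by (simp add: mult.commute)
    have "((\<lambda>t. piece \<xi> m (x / sqrt t)) \<longlongrightarrow> u m + slope \<xi> m * (1 - F_at m (a m) \<xi> m)) (at_right 0)"
      unfolding piece_def by (intro tendsto_intros F)
    moreover have "slope \<xi> m * (1 - F_at m (a m) \<xi> m) = u (m + 1) - u m"
      using gap_pos[OF \<xi>, of m a] a[of m] by (simp add: slope_def gap_def F_at_eq)
    ultimately show "((\<lambda>t. piece \<xi> m (x / sqrt t)) \<longlongrightarrow> u (m + 1)) (at_right 0)"
      by simp
    have "\<forall>\<^sub>F t in at_right 0. \<xi> m < x / sqrt t"
      using lim unfolding filterlim_at_top_dense by blast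
    then show "\<forall>\<^sub>F t in at_right 0. piece \<xi> m (x / sqrt t) = temperature \<xi> t x"
      by eventually_elim (auto simp: phase_def bdry_def intro!: temperature_eq_piece[of m, symmetric])
  qed
  ultimately show ?thesis by (simp add: riemann_data_def)
qed

end

lemma self_similar_solution_iff:
  "self_similar_solution m u a k d \<xi> \<longleftrightarrow> \<xi> \<in> Omega m \<and> (\<forall>i\<in>{1..m}. residual \<xi> i = 0)"
proof (cases "\<xi> \<in> Omega m")
  case True
  then show ?thesis
    unfolding self_similar_solution_def stefan_solution_def temperature_def[symmetric]
    using riemann_data_temperature[OF True]
    by (simp add: heat_equation_temperature stefan_condition_temperature_iff temperature_level)
qed (simp add: self_similar_solution_def)

end

theorem theorem1p4:
  fixes m :: nat and u a k d :: "nat \<Rightarrow> real"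
  assumes "m \<ge> 1"
    and "\<forall>i \<in> {0..m}. u i < u (i + 1)"
    and "\<forall>i \<in> {0..m}. a i > 0"
    and "\<forall>i \<in> {0..m}. k i > 0"
    and "\<forall>i \<in> {1..m}. d i \<ge> 0"
  shows "(\<exists>!\<xi>. self_similar_solution m u a k d \<xi>) \<and>
    (\<forall>\<xi>. self_similar_solution m u a k d \<xi> \<longrightarrow>
      (\<forall>\<eta>. is_arg_min (E m u a k d) (\<lambda>\<zeta>. \<zeta> \<in> Omega m) \<eta> \<longleftrightarrow> \<eta> = \<xi>)) \<and>
    strictly_convex_on (Omega m) (E m u a k d) \<and>
    coercive_on (Omega m) (E m u a k d)"
proof -
  interpret stefan_data m u a k d
    using assms by (simp add: stefan_data_def)
  show ?thesis
    unfolding self_similar_solution_iff coercive_on_def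
    by (intro conjI ex1_critical strictly_convex_energy)
      (simp_all add: is_arg_min_iff_if_critical compact_sublevel)
qed

end
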